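(* Let $G$ be a finite, simple, undirected, connected 2-degenerate graph on $n$ vertices. If $G$ is not a triangle (i.e. not isomorphic to $K_3$), then the edge set of $G$ can be partitioned into at most $\lfloor \frac{n}{2} \rfloor$ paths.
   Context: A graph $G$ is $k$-degenerate if every subgraph of $G$ has a vertex of degree at most $k$. A path decomposition of a graph is a partition of its edge set into (edge sets of) paths, where a path is a walk with all vertices and edges distinct. *)

theory Defs
  imports
    "Graph_Theory.Digraph"
    "Graph_Theory.Digraph_Component"
    "Graph_Theory.Vertex_Walk"
    "Graph_Theory.Kuratowski"
    "HOL-Library.Disjoint_Sets"
begin

text \<open>
  A finite simple undirected graph is represented by the locale predicate \<^const>\<open>graph\<close>:
  a finite loop-free digraph without parallel arcs whose adjacency relation is symmetric.
  Every undirected edge is thus a pair of opposite arcs; \<open>uedges\<close> identifies the two.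
\<close>

definition uedges :: "('a, 'b) pre_digraph \<Rightarrow> 'a set set" where
  "uedges G = (\<lambda>(u, v). {u, v}) ` arcs_ends G"

text \<open>
  Requiring \<^prop>\<open>graph H\<close> makes \<open>H\<close> range over the undirected subgraphs only (with each arc
  \<open>H\<close> contains its opposite), and for such \<open>H\<close> the out-degree is the undirected degree (see the lemma below).
  The null subgraph has no vertex at all and must be excluded.
\<close>

definition degenerate :: "nat \<Rightarrow> ('a, 'b) pre_digraph \<Rightarrow> bool" where
  "degenerate k G \<longleftrightarrow>
     (\<forall>H. graph H \<and> subgraph H G \<and> verts H \<noteq> {} \<longrightarrow> (\<exists>v\<in>verts H. out_degree H v \<le> k))"

lemma out_degree_eq_card_uedges:
  assumes "graph H"
  shows "out_degree H v = card {e \<in> uedges H. v \<in> e}"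
proof -
  have nomulti: "nomulti_digraph H" and sym: "symmetric H"
    using assms
    by (simp_all add: Digraph.graph_def digraph_def pseudo_graph_def sym_digraph_def
        sym_digraph_axioms_def)
  have inj: "inj_on (\<lambda>a. {tail H a, head H a}) (out_arcs H v)"
  proof (rule inj_onI)
    fix a b assume ab: "a \<in> out_arcs H v" "b \<in> out_arcs H v"
      and eq: "{tail H a, head H a} = {tail H b, head H b}"
    from ab have *: "a \<in> arcs H" "b \<in> arcs H" "tail H a = v" "tail H b = v"
      by (simp_all add: out_arcs_def)
    with eq have "head H a = head H b" by (metis doubleton_eq_iff)
    with * show "a = b"
      by (intro nomulti_digraph.no_multi_arcs[OF nomulti]) (simp_all add: arc_to_ends_def)
  qed
  have "(\<lambda>a. {tail H a, head H a}) ` out_arcs H v = {e \<in> uedges H. v \<in> e}"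
  proof
    show "(\<lambda>a. {tail H a, head H a}) ` out_arcs H v \<subseteq> {e \<in> uedges H. v \<in> e}"
      by (auto simp: out_arcs_def uedges_def arcs_ends_conv)
    show "{e \<in> uedges H. v \<in> e} \<subseteq> (\<lambda>a. {tail H a, head H a}) ` out_arcs H v"
    proof
      fix e assume "e \<in> {e \<in> uedges H. v \<in> e}"
      then obtain a where a: "a \<in> arcs H" "e = {tail H a, head H a}" "v \<in> e"
        by (auto simp: uedges_def arcs_ends_conv)
      obtain b where b: "b \<in> arcs H" "tail H a = head H b" "head H a = tail H b"
        using sym a(1) unfolding symmetric_conv by blast
      show "e \<in> (\<lambda>a. {tail H a, head H a}) ` out_arcs H v"
      proof (cases "tail H a = v")
        case True
        with a show ?thesis by (auto simp: out_arcs_def)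
      next
        case False
        with a(2,3) have "head H a = v" by blast
        with a(2) b have "b \<in> out_arcs H v" "e = {tail H b, head H b}"
          by (simp_all add: out_arcs_def insert_commute)
        then show ?thesis by blast
      qed
    qed
  qed
  with inj show ?thesis unfolding out_degree_def by (metis card_image)
qed

text \<open>
  A \<^const>\<open>vpath\<close> is a nonempty list of pairwise distinct vertices with consecutive ones adjacent;
  distinctness of its (undirected) edges follows.
\<close>

definition path_uedges :: "'a list \<Rightarrow> 'a set set" where
  "path_uedges p = (\<lambda>(u, v). {u, v}) ` set (vwalk_arcs p)"

text \<open>
  Blocks of \<^const>\<open>partition_on\<close> are nonempty, so one-vertex paths do not occur here.
\<close>

definition path_decomposition :: "('a, 'b) pre_digraph \<Rightarrow> 'a set set set \<Rightarrow> bool" where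
  "path_decomposition G P \<longleftrightarrow>
     partition_on (uedges G) P \<and> (\<forall>F\<in>P. \<exists>p. vpath p G \<and> F = path_uedges p)"

end

theory Submission
  imports Defs
begin

text \<open>
  Induction on the number of vertices, for possibly disconnected 2-degenerate graphs without triangle
  components. If all edges at two vertices \<open>u\<close> and \<open>v\<close> lie on one path, then that path is removed
  and pays for \<open>u\<close> and \<open>v\<close>. One edge \<open>{z, v}\<close> may even be missing from the path, provided that \<open>z\<close>
  has odd degree in the rest: some path of the rest then ends at \<open>z\<close> and is prolonged by this edge.
  Triangle components that arise in the rest are harmless, since a triangle and a path that touches it
  can be rewritten as two paths.

  In a minimal counterexample, two vertices of degree at most 2 are ruled out by extending a shortest path
  between them. So there is a single such vertex \<open>s\<close>, and by degeneracy some neighbour \<open>v\<close> of \<open>s\<close>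
  has degree exactly 3. The edge from \<open>v\<close> to another neighbour \<open>x\<close> is not a bridge, because the two
  sides of a bridge could be handled separately. A path from \<open>x\<close> to \<open>v\<close> that avoids this edge then
  leads to a path of the above kind for \<open>s\<close> and \<open>v\<close>.
\<close>

section \<open>Decompositions into paths and the absorption of triangles\<close>

lemma path_uedges_simps [simp]:
  "path_uedges [] = {}"
  "path_uedges [x] = {}"
  "path_uedges (x # y # zs) = insert {x, y} (path_uedges (y # zs))"
  by (auto simp: path_uedges_def)

lemma path_uedges_append:
  "path_uedges (xs @ y # ys) = path_uedges (xs @ [y]) \<union> path_uedges (y # ys)"
proof (induction xs)
  case (Cons x xs)
  then show ?case by (cases xs) auto
qed simp

lemma path_uedges_append_Cons [simp]:
  "path_uedges (xs @ y # z # ys) = path_uedges (xs @ [y]) \<union> insert {y, z} (path_uedges (z # ys))"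
  using path_uedges_append[of xs y "z # ys"] by simp

lemma path_uedges_rev [simp]: "path_uedges (rev p) = path_uedges p"
proof (induction p rule: induct_list012)
  case (3 x y zs)
  then show ?case using path_uedges_append[of "rev zs" y "[x]"] by auto
qed auto

lemma path_uedges_subset: "e \<in> path_uedges p \<Longrightarrow> e \<subseteq> set p"
  by (induction p rule: induct_list012) auto

lemma path_uedges_card: "distinct p \<Longrightarrow> e \<in> path_uedges p \<Longrightarrow> card e = 2"
  by (induction p rule: induct_list012) auto

lemma Union_path_uedges: "2 \<le> length p \<Longrightarrow> \<Union> (path_uedges p) = set p"
proof (induction p rule: induct_list012)
  case (3 x y zs)
  then show ?case by (cases zs) auto
qed auto

lemma finite_path_uedges [simp]: "finite (path_uedges p)"
  by (simp add: path_uedges_def)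

text \<open>A common edge would have to lie inside \<open>{y}\<close>, but every edge of a list with
  distinct vertices has two elements.\<close>

lemma path_uedges_disjoint:
  assumes "distinct p" "set p \<inter> set q \<subseteq> {y}"
  shows "path_uedges p \<inter> path_uedges q = {}"
proof -
  have False if e: "e \<in> path_uedges p" "e \<in> path_uedges q" for e
  proof -
    have "e \<subseteq> {y}" using path_uedges_subset e assms(2) by fast
    then have "card e \<le> 1" by (auto simp: subset_singleton_iff)
    then show False using path_uedges_card[OF assms(1) e(1)] by simp
  qed
  then show ?thesis by blast
qed

section \<open>Degrees with respect to an edge set\<close>

definition degr :: "'a set set \<Rightarrow> 'a \<Rightarrow> nat" where
  "degr E v = card {e \<in> E. v \<in> e}"

lemma degr_union: "finite E \<Longrightarrow> finite F \<Longrightarrow> E \<inter> F = {} \<Longrightarrow> degr (E \<union> F) v = degr E v + degr F v"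
proof -
  assume a: "finite E" "finite F" "E \<inter> F = {}"
  have "{e \<in> E \<union> F. v \<in> e} = {e \<in> E. v \<in> e} \<union> {e \<in> F. v \<in> e}" by auto
  then show ?thesis unfolding degr_def using a by (simp add: card_Un_disjoint disjoint_iff)
qed

lemma degr_insert: "finite E \<Longrightarrow> e \<notin> E \<Longrightarrow> degr (insert e E) v = degr E v + (if v \<in> e then 1 else 0)"
proof -
  assume a: "finite E" "e \<notin> E"
  have "{e' \<in> insert e E. v \<in> e'} = (if v \<in> e then insert e {e \<in> E. v \<in> e} else {e \<in> E. v \<in> e})" by auto
  then show ?thesis unfolding degr_def using a by simp
qed

lemma degr_eq_0: "v \<notin> \<Union> E \<Longrightarrow> degr E v = 0"
  unfolding degr_def by (metis (mono_tags, lifting) Collect_empty_eq UnionI card.empty)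

text \<open>The point is parity: a path contributes an odd number to the degree of a vertex exactly
  at its two ends.\<close>

lemma degr_path_uedges:
  assumes "distinct p" "2 \<le> length p"
  shows "degr (path_uedges p) z =
    (if z \<notin> set p then 0 else if z = hd p \<or> z = last p then 1 else 2)"
  using assms
proof (induction p rule: induct_list012)
  case (3 x y zs)
  have n: "{x, y} \<notin> path_uedges (y # zs)"
    using 3(3) path_uedges_subset[of "{x,y}" "y # zs"] by auto
  have d: "degr (path_uedges (x # y # zs)) z = degr (path_uedges (y # zs)) z + (if z \<in> {x, y} then 1 else 0)"
    using degr_insert[OF finite_path_uedges n] by simp
  show ?case
  proof (cases zs)
    case Nil
    then show ?thesis using d by (auto simp: degr_def)
  next
    case (Cons w ws)
    have "degr (path_uedges (y # zs)) z =
        (if z \<notin> set (y # zs) then 0 else if z = hd (y # zs) \<or> z = last (y # zs) then 1 else 2)"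
      using 3(2,3) Cons by simp
    moreover have "last zs \<noteq> y" "last zs \<noteq> x" "last zs \<in> set zs"
      using 3(3) Cons by (metis distinct.simps(2) last_in_set list.distinct(1) list.set_intros(2))+
    ultimately show ?thesis using d 3(3) Cons by auto
  qed
qed auto

text \<open>The number counts the paths. One-vertex paths are excluded so that each path has an
  edge, as the blocks of \<open>partition_on\<close> must be nonempty.\<close>

inductive decomposes :: "'a set set \<Rightarrow> nat \<Rightarrow> bool" where
  decomposes_empty: "decomposes {} 0"
| decomposes_path: "decomposes E k \<Longrightarrow> distinct p \<Longrightarrow> 2 \<le> length p \<Longrightarrow> path_uedges p \<inter> E = {} \<Longrightarrow>
    decomposes (path_uedges p \<union> E) (Suc k)"

lemma decomposes_finite: "decomposes E k \<Longrightarrow> finite E"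
  by (induction rule: decomposes.induct) auto

lemma decomposes_union: "decomposes E k \<Longrightarrow> decomposes F m \<Longrightarrow> E \<inter> F = {} \<Longrightarrow> decomposes (E \<union> F) (k + m)"
proof (induction rule: decomposes.induct)
  case (decomposes_path E k p)
  then have "decomposes (path_uedges p \<union> (E \<union> F)) (Suc (k + m))"
    by (intro decomposes.decomposes_path) auto
  then show ?case by (simp add: Un_assoc)
qed simp

lemma decomposes_single: "distinct p \<Longrightarrow> 2 \<le> length p \<Longrightarrow> decomposes (path_uedges p) 1"
  using decomposes_path[OF decomposes_empty] by fastforce

text \<open>The order in which the paths were added is immaterial, so a path through
  \<open>z\<close> can be treated as the one added last.\<close>

lemma decomposes_extract:
  assumes "decomposes E k" "z \<in> \<Union> E"
  obtains p F j where "k = Suc j" "decomposes F j" "distinct p" "2 \<le> length p"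
    "path_uedges p \<inter> F = {}" "E = path_uedges p \<union> F" "z \<in> set p"
  using assms
proof (induction arbitrary: thesis rule: decomposes.induct)
  case (decomposes_path E k p)
  show ?case
  proof (cases "z \<in> set p")
    case True
    then show ?thesis using decomposes_path by blast
  next
    case False
    then have "z \<in> \<Union> E" using decomposes_path.prems(2) Union_path_uedges decomposes_path.hyps by fastforce
    then obtain q F j where q: "k = Suc j" "decomposes F j" "distinct q" "2 \<le> length q"
      "path_uedges q \<inter> F = {}" "E = path_uedges q \<union> F" "z \<in> set q"
      using decomposes_path.IH by metis
    have "decomposes (path_uedges p \<union> F) (Suc j)" using q decomposes_path.hyps by (intro decomposes.decomposes_path) auto
    then show ?thesis using q decomposes_path.hyps by (intro decomposes_path.prems(1)[of "Suc j" "path_uedges p \<union> F" q]) auto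
  qed
qed auto

text \<open>A path that does not end at \<open>z\<close> contributes 0 or 2 to the degree of
  \<open>z\<close>, so an odd degree forces some path to end there. Reversal puts \<open>z\<close>
  in front.\<close>

lemma decomposes_extract_end:
  assumes "decomposes E k" "odd (degr E z)"
  obtains p F j where "k = Suc j" "decomposes F j" "distinct p" "2 \<le> length p"
    "path_uedges p \<inter> F = {}" "E = path_uedges p \<union> F" "hd p = z"
  using assms
proof (induction arbitrary: thesis rule: decomposes.induct)
  case (decomposes_path E k p)
  consider (h) "z = hd p" | (l) "z = last p" | (n) "z \<noteq> hd p" "z \<noteq> last p" by blast
  then show ?case
  proof cases
    case h
    then show ?thesis using decomposes_path.prems(1)[of k E p] decomposes_path.hyps by simp
  next
    case l
    then show ?thesis using decomposes_path.prems(1)[of k E "rev p"] decomposes_path.hyps by (simp add: hd_rev)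
  next
    case n
    then have "even (degr (path_uedges p) z)" using degr_path_uedges[of p z] decomposes_path.hyps by simp
    then have "odd (degr E z)"
      using decomposes_path.prems(2) degr_union[of "path_uedges p" E z] decomposes_path.hyps decomposes_finite[OF decomposes_path.hyps(1)] by simp
    then obtain q F j where q: "k = Suc j" "decomposes F j" "distinct q" "2 \<le> length q"
      "path_uedges q \<inter> F = {}" "E = path_uedges q \<union> F" "hd q = z"
      using decomposes_path.IH by metis
    have "decomposes (path_uedges p \<union> F) (Suc j)" using q decomposes_path.hyps by (intro decomposes.decomposes_path) auto
    then show ?thesis using q decomposes_path.hyps by (intro decomposes_path.prems(1)[of "Suc j" "path_uedges p \<union> F" q]) auto
  qed
qed (auto simp: degr_def)

text \<open>The new edge is put in front of a path that starts at \<open>z\<close>. The result is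
  still a path because no edge of \<open>E\<close> touches \<open>v\<close>.\<close>

lemma decomposes_extend:
  assumes "decomposes E k" "odd (degr E z)" "v \<notin> \<Union> E" "v \<noteq> z"
  shows "decomposes (insert {z, v} E) k"
proof -
  obtain p F j where p: "k = Suc j" "decomposes F j" "distinct p" "2 \<le> length p"
    "path_uedges p \<inter> F = {}" "E = path_uedges p \<union> F" "hd p = z"
    using decomposes_extract_end[OF assms(1,2)] .
  obtain zs where zs: "p = z # zs" using p(4,7) by (cases p) auto
  have v: "v \<notin> set p" using assms(3) p(4,6) Union_path_uedges by fastforce
  have pe: "path_uedges (v # p) = insert {v, z} (path_uedges p)" using zs by simp
  have "{v, z} \<notin> F" using assms(3) p(6) by blast
  then have "decomposes (path_uedges (v # p) \<union> F) (Suc j)"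
    using p(3-5) v unfolding pe by (intro decomposes.decomposes_path[OF p(2), of "v # p", unfolded pe]) simp_all
  then show ?thesis unfolding pe p(1,6) by (simp add: insert_commute)
qed

section \<open>Triangles and the paths that meet them\<close>

definition triangle :: "'a \<Rightarrow> 'a \<Rightarrow> 'a \<Rightarrow> 'a set set" where
  "triangle a b c = {{a, b}, {b, c}, {a, c}}"

lemma triangle_commute: "triangle a b c = triangle b a c" "triangle a b c = triangle a c b"
  by (auto simp: triangle_def insert_commute)

text \<open>The path is cut at \<open>t\<close>: the first part continues along \<open>t\<close>,
  \<open>u\<close>, \<open>w\<close>, and the second part is entered from \<open>w\<close> by the
  edge \<open>{w, t}\<close>. The vertex \<open>u\<close> may still occur in
  \<open>Q\<close>.\<close>

lemma absorb_triangle_avoiding: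
  assumes p: "p = P @ t # Q" "distinct p" and d: "t \<noteq> u" "t \<noteq> w" "u \<noteq> w"
    and n: "u \<notin> set P" "w \<notin> set P" "w \<notin> set Q" and e: "path_uedges p \<inter> triangle t u w = {}"
  shows "decomposes (path_uedges p \<union> triangle t u w) 2"
proof -
  let ?A = "P @ [t, u, w]" and ?B = "w # t # Q"
  have pe: "path_uedges p = path_uedges (P @ [t]) \<union> path_uedges (t # Q)"
    using path_uedges_append p(1) by metis
  have dj: "path_uedges (P @ [t]) \<inter> path_uedges (t # Q) = {}"
    using p by (intro path_uedges_disjoint[of _ _ t]) auto
  have B: "decomposes (path_uedges ?B) 1" using p d n by (intro decomposes_single) auto
  have "decomposes (path_uedges ?A \<union> path_uedges ?B) (Suc 1)"
  proof (rule decomposes_path[OF B])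
    show "distinct ?A" using p d n by auto
    show "path_uedges ?A \<inter> path_uedges ?B = {}"
      using dj e d unfolding pe by (auto simp: triangle_def doubleton_eq_iff insert_commute)
  qed simp
  moreover have "path_uedges ?A \<union> path_uedges ?B = path_uedges p \<union> triangle t u w"
    unfolding pe by (auto simp: triangle_def insert_commute)
  ultimately show ?thesis by (simp add: numeral_2_eq_2)
qed

text \<open>
  If the path visits \<open>t\<close>, \<open>u\<close>, \<open>w\<close> in this order, then the first new path shortcuts along \<open>{u, w}\<close>
  and runs the segment between \<open>u\<close> and \<open>w\<close> backwards up to the edge at \<open>u\<close>; that edge, the two
  triangle edges at \<open>t\<close> and the tail after \<open>w\<close> form the second one.
\<close>
lemma absorb_triangle_in_order:
  assumes p: "p = P @ t # Q @ u # R @ w # S" "distinct p" and e: "path_uedges p \<inter> triangle t u w = {}"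
  shows "decomposes (path_uedges p \<union> triangle t u w) 2"
proof -
  \<comment> \<open>With \<open>R\<close> empty, \<open>{u, w}\<close> would be an edge of both the
    path and the triangle.\<close>
  have "R \<noteq> []" using e p(1) path_uedges_append[of "P @ t # Q" u "w # S"] by (auto simp: triangle_def)
  then obtain r R' where R: "R = r # R'" by (cases R) auto
  let ?A = "P @ t # Q @ u # w # rev R" and ?B = "r # u # t # w # S"
  have p2: "p = (P @ t # Q) @ u # r # (R' @ w # S)" using p R by simp
  have pe: "path_uedges p = path_uedges (P @ t # Q @ [u]) \<union>
      ({{u, r}} \<union> path_uedges (R @ [w]) \<union> path_uedges (w # S))"
    using path_uedges_append[of "P @ t # Q" u "r # R' @ w # S"]
      path_uedges_append[of "r # R'" w S] p2 R by auto
  have rv: "path_uedges (w # rev R) = path_uedges (R @ [w])"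
    using path_uedges_rev[of "R @ [w]"] by simp
  have A: "path_uedges ?A = path_uedges (P @ t # Q @ [u]) \<union> ({{u, w}} \<union> path_uedges (R @ [w]))"
    using path_uedges_append[of "P @ t # Q" u "w # rev R"] rv by (simp del: path_uedges_append_Cons)
  have B: "path_uedges ?B = {{r, u}, {u, t}, {t, w}} \<union> path_uedges (w # S)" by auto
  have d1: "path_uedges (P @ t # Q @ [u]) \<inter> path_uedges (w # S) = {}"
    using p by (intro path_uedges_disjoint[of _ _ t]) auto
  have d2: "path_uedges (R @ [w]) \<inter> path_uedges (w # S) = {}"
    using p by (intro path_uedges_disjoint[of _ _ w]) auto
  have d3: "{u, r} \<notin> path_uedges (P @ t # Q @ [u])" "{u, r} \<notin> path_uedges (R @ [w])"
    using path_uedges_subset[of "{u,r}"] p R by fastforce+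
  have Bp: "decomposes (path_uedges ?B) 1" using p R by (intro decomposes_single) auto
  have "decomposes (path_uedges ?A \<union> path_uedges ?B) (Suc 1)"
  proof (rule decomposes_path[OF Bp])
    show "distinct ?A" using p by auto
    have ne: "{u, w} \<notin> path_uedges (w # S)"
      using e unfolding pe by (auto simp: triangle_def insert_commute)
    have nf: "{u, w} \<noteq> {u, r}" "{u, w} \<noteq> {t, u}" "{u, w} \<noteq> {t, w}"
      using p R by (auto simp: doubleton_eq_iff)
    show "path_uedges ?A \<inter> path_uedges ?B = {}"
      unfolding A B using d1 d2 d3 ne nf e unfolding pe by (auto simp: triangle_def insert_commute)
  qed simp
  moreover have "path_uedges ?A \<union> path_uedges ?B = path_uedges p \<union> triangle t u w"
    unfolding pe A B by (auto simp: triangle_def insert_commute)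
  ultimately show ?thesis by (simp add: numeral_2_eq_2)
qed

text \<open>If \<open>Q\<close> misses \<open>u\<close> or \<open>w\<close>, cutting at
  \<open>t\<close> suffices, with \<open>u\<close> and \<open>w\<close> exchanged where necessary.
  Otherwise both follow \<open>t\<close> in one of two orders, and
  \<open>absorb_triangle_in_order\<close> covers each.\<close>

lemma absorb_triangle_at_first:
  assumes p: "p = P @ t # Q" "distinct p" and d: "t \<noteq> u" "t \<noteq> w" "u \<noteq> w"
    and n: "u \<notin> set P" "w \<notin> set P" and e: "path_uedges p \<inter> triangle t u w = {}"
  shows "decomposes (path_uedges p \<union> triangle t u w) 2"
proof -
  have c: "triangle t u w = triangle t w u" by (rule triangle_commute)
  consider "w \<notin> set Q" | "u \<notin> set Q" | "u \<in> set Q" "w \<in> set Q" by blast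
  then show ?thesis
  proof cases
    case 1
    then show ?thesis using absorb_triangle_avoiding assms by metis
  next
    case 2
    then show ?thesis using absorb_triangle_avoiding[OF p, of w u] assms c by auto
  next
    case 3
    then obtain Q1 Q2 where q: "Q = Q1 @ u # Q2" by (meson split_list)
    consider "w \<in> set Q1" | "w \<in> set Q2" using 3 q d by auto
    then show ?thesis
    proof cases
      case 1
      then obtain R S where "Q1 = R @ w # S" by (meson split_list)
      then show ?thesis using absorb_triangle_in_order[of p P t R w S u Q2] p q e c by simp
    next
      case 2
      then obtain R S where "Q2 = R @ w # S" by (meson split_list)
      then show ?thesis using absorb_triangle_in_order[of p P t Q1 u R w S] p q e by simp
    qed
  qed
qed

lemma absorb_triangle:
  assumes "distinct p" "a \<noteq> b" "b \<noteq> c" "a \<noteq> c" "set p \<inter> {a, b, c} \<noteq> {}"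
    "path_uedges p \<inter> triangle a b c = {}"
  shows "decomposes (path_uedges p \<union> triangle a b c) 2"
proof -
  have "\<exists>x\<in>set p. x \<in> {a, b, c}" using assms(5) by auto
  \<comment> \<open>\<open>t\<close> is the first corner on the path; by the symmetry of
    \<open>triangle\<close>, any of the three may take this role.\<close>
  then obtain P t Q where p: "p = P @ t # Q" "t \<in> {a, b, c}" "\<forall>x\<in>set P. x \<notin> {a, b, c}"
    using split_list_first_prop[of p "\<lambda>x. x \<in> {a, b, c}"] by blast
  consider "t = a" | "t = b" | "t = c" using p(2) by blast
  then show ?thesis
  proof cases
    case 1
    show ?thesis by (rule absorb_triangle_at_first[OF p(1)[unfolded 1] assms(1)]) (use assms(2-4,6) p(3) in auto)
  next
    case 2
    have eq: "triangle a b c = triangle b a c" by (rule triangle_commute)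
    show ?thesis unfolding eq
      by (rule absorb_triangle_at_first[OF p(1)[unfolded 2] assms(1)]) (use assms(2-4,6) p(3) eq in auto)
  next
    case 3
    have eq: "triangle a b c = triangle c a b" by (auto simp: triangle_def insert_commute)
    show ?thesis unfolding eq
      by (rule absorb_triangle_at_first[OF p(1)[unfolded 3] assms(1)]) (use assms(2-4,6) p(3) eq in auto)
  qed
qed

text \<open>Only one path that touches the triangle is replaced, by two new ones, so the count grows
  by one.\<close>

lemma decomposes_absorb:
  assumes "decomposes E k" "a \<noteq> b" "b \<noteq> c" "a \<noteq> c" "\<Union> E \<inter> {a, b, c} \<noteq> {}" "E \<inter> triangle a b c = {}"
  shows "decomposes (E \<union> triangle a b c) (Suc k)"
proof -
  obtain z where z: "z \<in> \<Union> E" "z \<in> {a, b, c}" using assms(5) by blast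
  obtain p F j where p: "k = Suc j" "decomposes F j" "distinct p" "2 \<le> length p"
    "path_uedges p \<inter> F = {}" "E = path_uedges p \<union> F" "z \<in> set p"
    using decomposes_extract[OF assms(1) z(1)] .
  have "decomposes (path_uedges p \<union> triangle a b c) 2"
    using absorb_triangle[of p a b c] p assms z by blast
  then have "decomposes ((path_uedges p \<union> triangle a b c) \<union> F) (2 + j)"
    using p assms by (intro decomposes_union) auto
  moreover have "(path_uedges p \<union> triangle a b c) \<union> F = E \<union> triangle a b c" using p by auto
  ultimately show ?thesis using p by simp
qed

section \<open>Removing two vertices with one path\<close>

definition ugraph :: "'a set \<Rightarrow> 'a set set \<Rightarrow> bool" where
  "ugraph V E \<longleftrightarrow> finite V \<and> (\<forall>e\<in>E. e \<subseteq> V \<and> card e = 2)"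

text \<open>Induced subgraphs suffice, since dropping further edges only lowers degrees.\<close>

definition two_degen :: "'a set \<Rightarrow> 'a set set \<Rightarrow> bool" where
  "two_degen V E \<longleftrightarrow> ugraph V E \<and> (\<forall>W\<subseteq>V. W \<noteq> {} \<longrightarrow> (\<exists>v\<in>W. degr {e \<in> E. e \<subseteq> W} v \<le> 2))"

text \<open>Since \<open>a\<close>, \<open>b\<close>, \<open>c\<close> have degree 2, the triangle is a whole component.\<close>
definition triangle_component :: "'a set set \<Rightarrow> 'a \<Rightarrow> 'a \<Rightarrow> 'a \<Rightarrow> bool" where
  "triangle_component E a b c \<longleftrightarrow> a \<noteq> b \<and> b \<noteq> c \<and> a \<noteq> c \<and> triangle a b c \<subseteq> E \<and>
     degr E a = 2 \<and> degr E b = 2 \<and> degr E c = 2"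

definition no_triangle_component :: "'a set set \<Rightarrow> bool" where
  "no_triangle_component E \<longleftrightarrow> (\<forall>a b c. \<not> triangle_component E a b c)"

definition good :: "'a set \<Rightarrow> 'a set set \<Rightarrow> bool" where
  "good V E \<longleftrightarrow> (\<exists>k \<le> card V div 2. decomposes E k)"

definition nbrs :: "'a set set \<Rightarrow> 'a \<Rightarrow> 'a set" where
  "nbrs E v = {w. {v, w} \<in> E}"

lemma ugraph_finite: "ugraph V E \<Longrightarrow> finite E"
  unfolding ugraph_def by (rule finite_subset[of E "Pow V"]) auto

lemma ugraph_irrefl:
  assumes "ugraph V E" "{v, w} \<in> E" shows "v \<noteq> w \<and> v \<in> V \<and> w \<in> V"
proof -
  have "{v, w} \<subseteq> V" "card {v, w} = 2" using assms unfolding ugraph_def by blast+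
  then show ?thesis by (cases "v = w") simp_all
qed

lemma ugraph_edge:
  assumes "ugraph V E" "e \<in> E" "v \<in> e" obtains w where "e = {v, w}"
proof -
  have "card e = 2" using assms unfolding ugraph_def by blast
  then obtain a b where e: "e = {a, b}" by (meson card_2_iff)
  then consider "v = a" | "v = b" using assms(3) by blast
  then show ?thesis using that[of a] that[of b] e by cases (simp_all add: insert_commute)
qed

lemma ugraph_sub: "ugraph V E \<Longrightarrow> W \<subseteq> V \<Longrightarrow> F \<subseteq> E \<Longrightarrow> \<forall>e\<in>F. e \<subseteq> W \<Longrightarrow> ugraph W F"
  unfolding ugraph_def by (simp add: finite_subset subset_iff)

lemma degr_mono: "finite E \<Longrightarrow> F \<subseteq> E \<Longrightarrow> degr F v \<le> degr E v"
  unfolding degr_def by (intro card_mono) auto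

lemma two_degen_sub:
  assumes "two_degen V E" "W \<subseteq> V" "F \<subseteq> E" "\<forall>e\<in>F. e \<subseteq> W"
  shows "two_degen W F"
  unfolding two_degen_def
proof (intro conjI allI impI)
  have simple_graph: "ugraph V E" using assms(1) unfolding two_degen_def by blast
  then show "ugraph W F" by (rule ugraph_sub[OF _ assms(2-4)])
  fix U assume U: "U \<subseteq> W" "U \<noteq> {}"
  then obtain v where v: "v \<in> U" "degr {e \<in> E. e \<subseteq> U} v \<le> 2"
    using assms(1,2) unfolding two_degen_def by blast
  have "finite E" using ugraph_finite[OF simple_graph] .
  then have "degr {e \<in> F. e \<subseteq> U} v \<le> degr {e \<in> E. e \<subseteq> U} v"
    using assms(3) by (intro degr_mono) auto
  then show "\<exists>v\<in>U. degr {e \<in> F. e \<subseteq> U} v \<le> 2" using v by (meson le_trans)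
qed

lemma degr_nbrs: assumes "ugraph V E" shows "degr E v = card (nbrs E v)"
proof -
  have "inj_on (\<lambda>w. {v, w}) (nbrs E v)" by (auto simp: inj_on_def doubleton_eq_iff)
  moreover have "(\<lambda>w. {v, w}) ` nbrs E v = {e \<in> E. v \<in> e}"
  proof (intro equalityI subsetI)
    fix e assume "e \<in> {e \<in> E. v \<in> e}"
    then show "e \<in> (\<lambda>w. {v, w}) ` nbrs E v"
      using ugraph_edge[OF assms, of e v] by (auto simp: nbrs_def)
  qed (auto simp: nbrs_def)
  ultimately show ?thesis unfolding degr_def by (metis card_image)
qed

lemma finite_nbrs: "ugraph V E \<Longrightarrow> finite (nbrs E v)"
  using ugraph_irrefl[of V E v] by (intro finite_subset[of "nbrs E v" V]) (auto simp: nbrs_def ugraph_def)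

lemma degr_cong: "{e \<in> E. v \<in> e} = {e \<in> F. v \<in> e} \<Longrightarrow> degr E v = degr F v"
  unfolding degr_def by simp

lemma degr_Diff:
  "finite E \<Longrightarrow> F \<subseteq> E \<Longrightarrow> degr E v = degr (E - F) v + degr F v"
  by (subst degr_union[symmetric]) (auto simp: finite_subset Un_absorb2)

text \<open>Each corner has degree 2, and the two triangle edges at it already account for
  that.\<close>

lemma triangle_component_edges:
  assumes "triangle_component E a b c" "finite E" "e \<in> E" "e \<inter> {a, b, c} \<noteq> {}"
  shows "e \<in> triangle a b c"
proof -
  have *: "e \<in> triangle x y z" if t: "triangle_component E x y z" and x: "x \<in> e" for x y z
  proof -
    have "{x, y} \<noteq> {x, z}" using t unfolding triangle_component_def by (auto simp: doubleton_eq_iff)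
    then have "card {{x, y}, {x, z}} = 2" by simp
    moreover have "{{x, y}, {x, z}} \<subseteq> {e \<in> E. x \<in> e}"
      using t unfolding triangle_component_def triangle_def by simp
    ultimately have "{{x, y}, {x, z}} = {e \<in> E. x \<in> e}"
      using t assms(2) unfolding triangle_component_def degr_def by (intro card_subset_eq) simp_all
    then show ?thesis using x assms(3) unfolding triangle_def by auto
  qed
  have eq: "triangle b a c = triangle a b c" "triangle c a b = triangle a b c" by (auto simp: triangle_def insert_commute)
  have t: "triangle_component E b a c" "triangle_component E c a b"
    using assms(1) unfolding triangle_component_def eq by auto
  consider "a \<in> e" | "b \<in> e" | "c \<in> e" using assms(4) by blast
  then show ?thesis using *[OF assms(1)] *[OF t(1)] *[OF t(2)] unfolding eq by cases
qed

text \<open>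
  Triangle components of the rest \<open>F\<close> cost one path more than their share of vertices pays for;
  each of them is absorbed into a path that touches it.
\<close>
lemma decomposes_path_absorb:
  fixes W :: "'a set"
  assumes "\<And>(U :: 'a set) F. card U \<le> card W \<Longrightarrow> two_degen U F \<Longrightarrow> no_triangle_component F \<Longrightarrow> good U F"
    and "two_degen W F" "distinct p" "2 \<le> length p" "F \<inter> (path_uedges p \<union> A) = {}" "path_uedges p \<inter> A = {}"
    and "A = {} \<or> A = {{z, v}} \<and> v \<notin> \<Union> F \<and> v \<noteq> z \<and> odd (degr F z)"
    and "\<And>a b c. triangle_component F a b c \<Longrightarrow> set p \<inter> {a, b, c} \<noteq> {}"
  shows "\<exists>k \<le> card W div 2 + 1. decomposes (F \<union> A \<union> path_uedges p) k"
  using assms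
proof (induction "card W" arbitrary: W F rule: less_induct)
  case less
  have simple_graph: "ugraph W F" and fin: "finite F" "finite W"
    using less.prems(2) ugraph_finite unfolding two_degen_def ugraph_def by blast+
  show ?case
  proof (cases "no_triangle_component F")
    case True
    have "good W F" using less.prems(1)[OF order_refl less.prems(2) True] .
    then obtain k where k: "k \<le> card W div 2" "decomposes F k" unfolding good_def by blast
    \<comment> \<open>If \<open>A\<close> consists of an edge, it prolongs a path of
      \<open>F\<close> that ends at \<open>z\<close>, at no cost.\<close>
    have "decomposes (F \<union> A) k" using less.prems(7) k(2) decomposes_extend[of F k z v] by auto
    then have "decomposes (path_uedges p \<union> (F \<union> A)) (Suc k)" using less.prems(3-6) by (intro decomposes_path) auto
    then show ?thesis using k by (intro exI[of _ "Suc k"]) (simp add: Un_commute)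
  next
    case False
    then obtain a b c where t: "triangle_component F a b c" unfolding no_triangle_component_def by blast
    define T where "T = triangle a b c"
    define W' where "W' = W - {a, b, c}"
    define F' where "F' = F - T"
    have d: "a \<noteq> b" "b \<noteq> c" "a \<noteq> c" "T \<subseteq> F" using t unfolding triangle_component_def T_def by auto
    have TV: "{a, b, c} \<subseteq> W" using d simple_graph unfolding T_def triangle_def ugraph_def by auto
    have "card {a, b, c} = 3" "card {a, b, c} \<le> card W" using d card_mono[OF fin(2) TV] by simp_all
    then have cW: "card W = card W' + 3"
      unfolding W'_def using TV by (simp add: card_Diff_subset)
    have off: "e \<inter> {a, b, c} = {}" if "e \<in> F'" for e
      using triangle_component_edges[OF t fin(1), of e] that unfolding F'_def T_def by auto
    have sub: "two_degen W' F'"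
    proof (rule two_degen_sub[OF less.prems(2)])
      show "\<forall>e\<in>F'. e \<subseteq> W'" using off simple_graph unfolding W'_def F'_def ugraph_def by blast
    qed (auto simp: W'_def F'_def)
    have dg: "degr F' x = degr F x" if "x \<notin> {a, b, c}" for x
      by (rule degr_cong) (use that in \<open>auto simp: F'_def T_def triangle_def\<close>)
    have "\<exists>k \<le> card W' div 2 + 1. decomposes (F' \<union> A \<union> path_uedges p) k"
    proof (rule less.hyps)
      show "card W' < card W" using cW by simp
      show "\<And>(U :: 'a set) F. card U \<le> card W' \<Longrightarrow> two_degen U F \<Longrightarrow> no_triangle_component F \<Longrightarrow> good U F"
        using less.prems(1) cW by simp
      show "two_degen W' F'" by (rule sub)
      show "F' \<inter> (path_uedges p \<union> A) = {}" using less.prems(5) unfolding F'_def by blast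
      show "A = {} \<or> A = {{z, v}} \<and> v \<notin> \<Union> F' \<and> v \<noteq> z \<and> odd (degr F' z)"
      proof (cases "A = {}")
        case False
        then have o: "odd (degr F z)" using less.prems(7) by blast
        \<comment> \<open>Corners have the even degree 2, so \<open>z\<close> is none of them and
          keeps its odd degree when the triangle is removed.\<close>
        then have "z \<notin> {a, b, c}" using t unfolding triangle_component_def by auto
        then show ?thesis using less.prems(7) dg unfolding F'_def by auto
      qed simp
      show "set p \<inter> {a', b', c'} \<noteq> {}" if t': "triangle_component F' a' b' c'" for a' b' c'
      proof (rule less.prems(8))
        have "triangle a' b' c' \<subseteq> F'" using t' unfolding triangle_component_def by blast
        then have "{a', b', c'} \<inter> {a, b, c} = {}" using off unfolding triangle_def by blast
        then show "triangle_component F a' b' c'"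
          using t' dg unfolding triangle_component_def F'_def by auto
      qed
    qed (use less.prems in auto)
    then obtain k where k: "k \<le> card W' div 2 + 1" "decomposes (F' \<union> A \<union> path_uedges p) k" by blast
    have "decomposes ((F' \<union> A \<union> path_uedges p) \<union> triangle a b c) (Suc k)"
    proof (rule decomposes_absorb[OF k(2) d(1-3)])
      \<comment> \<open>Some path of the decomposition must touch the triangle; this holds since all
        vertices of \<open>p\<close> are covered and \<open>p\<close> meets the triangle.\<close>
      have "set p \<subseteq> \<Union> (F' \<union> A \<union> path_uedges p)" using Union_path_uedges[OF less.prems(4)] by auto
      then show "\<Union> (F' \<union> A \<union> path_uedges p) \<inter> {a, b, c} \<noteq> {}" using less.prems(8)[OF t] by blast
      show "(F' \<union> A \<union> path_uedges p) \<inter> triangle a b c = {}"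
        using d(4) less.prems(5) unfolding F'_def T_def by blast
    qed
    moreover have "(F' \<union> A \<union> path_uedges p) \<union> triangle a b c = F \<union> A \<union> path_uedges p"
      using d(4) unfolding F'_def T_def by blast
    \<comment> \<open>The three corners pay for the extra path, as
      \<open>card W' div 2 + 1 \<le> (card W' + 3) div 2\<close>.\<close>
    ultimately show ?thesis using k(1) cW by (intro exI[of _ "Suc k"]) auto
  qed
qed

section \<open>The induction step: a path that pays for two vertices\<close>

locale induction_step =
  fixes V :: "'a set" and E :: "'a set set"
  assumes degen: "two_degen V E"
    and no_triangle: "no_triangle_component E"
    and IH: "\<And>(W :: 'a set) F. card W < card V \<Longrightarrow> two_degen W F \<Longrightarrow> no_triangle_component F \<Longrightarrow> good W F"
begin

lemma simple_graph: "ugraph V E" using degen unfolding two_degen_def by blast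

lemma fin: "finite V" "finite E" using simple_graph ugraph_finite unfolding ugraph_def by auto

text \<open>
  The edges at \<open>u\<close> and \<open>v\<close> lie on the path \<open>p\<close>, except for the edge in \<open>A\<close> (if any), which is
  appended to a path of the rest ending at \<open>z\<close>. So one new path pays for two vertices.
\<close>
lemma reduce:
  assumes p: "distinct p" "2 \<le> length p" "path_uedges p \<subseteq> E"
    and uv: "u \<in> V" "v \<in> V" "u \<noteq> v"
    and iso: "\<And>w. {u, w} \<in> E \<Longrightarrow> {u, w} \<in> path_uedges p \<union> A" "\<And>w. {v, w} \<in> E \<Longrightarrow> {v, w} \<in> path_uedges p \<union> A"
    and A: "A = {} \<or> A = {{z, v}} \<and> {z, v} \<in> E - path_uedges p \<and> even (degr E z + degr (path_uedges p) z)"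
  shows "good V E"
proof -
  define W where "W = V - {u, v}"
  define F where "F = E - (path_uedges p \<union> A)"
  have "card {u, v} = 2" "card {u, v} \<le> card V" using uv card_mono[OF fin(1), of "{u, v}"] by simp_all
  then have cW: "card V = card W + 2" unfolding W_def using uv by (simp add: card_Diff_subset)
  have off: "u \<notin> e \<and> v \<notin> e" if e: "e \<in> F" for e
  proof -
    have eE: "e \<in> E" "e \<notin> path_uedges p \<union> A" using e unfolding F_def by auto
    have "u \<notin> e"
    proof
      assume "u \<in> e"
      then obtain w where "e = {u, w}" using ugraph_edge[OF simple_graph eE(1)] by blast
      then show False using iso(1) eE by blast
    qed
    moreover have "v \<notin> e"
    proof
      assume "v \<in> e"
      then obtain w where "e = {v, w}" using ugraph_edge[OF simple_graph eE(1)] by blast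
      then show False using iso(2) eE by blast
    qed
    ultimately show ?thesis by blast
  qed
  have sub: "two_degen W F"
  proof (rule two_degen_sub[OF degen])
    show "\<forall>e\<in>F. e \<subseteq> W" using off simple_graph unfolding W_def F_def ugraph_def by blast
  qed (auto simp: W_def F_def)
  have AE: "path_uedges p \<union> A \<subseteq> E" "path_uedges p \<inter> A = {}" using p A by auto
  have A': "A = {} \<or> A = {{z, v}} \<and> v \<notin> \<Union> F \<and> v \<noteq> z \<and> odd (degr F z)"
  proof (cases "A = {}")
    case False
    then have A: "A = {{z, v}}" "{z, v} \<in> E - path_uedges p" "even (degr E z + degr (path_uedges p) z)"
      using A by auto
    have "degr E z = degr F z + degr (path_uedges p \<union> A) z"
      unfolding F_def using degr_Diff[OF fin(2) AE(1)] .
    moreover have "degr (path_uedges p \<union> A) z = degr (path_uedges p) z + 1"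
      using degr_insert[of "path_uedges p" "{z, v}" z] A by simp
    \<comment> \<open>Besides its degree on the path, \<open>z\<close> loses one for the edge
      \<open>{z, v}\<close>, and this one flips the parity.\<close>
    ultimately have "odd (degr F z)" using A(3) by auto
    then show ?thesis using A off ugraph_irrefl[OF simple_graph] by auto
  qed simp
  have "\<exists>k \<le> card W div 2 + 1. decomposes (F \<union> A \<union> path_uedges p) k"
  proof (rule decomposes_path_absorb[OF _ sub p(1,2) _ AE(2) A'])
    show "\<And>(U :: 'a set) F. card U \<le> card W \<Longrightarrow> two_degen U F \<Longrightarrow> no_triangle_component F \<Longrightarrow> good U F"
      using IH cW by simp
    show "F \<inter> (path_uedges p \<union> A) = {}" unfolding F_def by blast
    fix a b c assume t: "triangle_component F a b c"
    \<comment> \<open>A triangle component of \<open>F\<close> that is none of \<open>E\<close> has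
      lost an edge at some corner \<open>x\<close>. Degree 2 in \<open>F\<close> rules out
      \<open>v\<close>, which has degree 0, and the vertex \<open>z\<close> of odd degree in case
      \<open>A\<close> is an edge. So the lost edge lies on \<open>p\<close>.\<close>
    have "\<not> triangle_component E a b c" using no_triangle unfolding no_triangle_component_def by blast
    then have "degr E a \<noteq> degr F a \<or> degr E b \<noteq> degr F b \<or> degr E c \<noteq> degr F c"
      using t unfolding triangle_component_def F_def by auto
    then obtain x where x: "x \<in> {a, b, c}" "degr E x \<noteq> degr F x" by blast
    have x2: "degr F x = 2" using x t unfolding triangle_component_def by blast
    have "{e \<in> E. x \<in> e} \<noteq> {e \<in> F. x \<in> e}" using x(2) degr_cong by metis
    then obtain e where e: "x \<in> e" "e \<in> path_uedges p \<union> A" unfolding F_def by blast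
    have "x \<noteq> v" using x2 off degr_eq_0[of v F] by auto
    moreover have "x \<noteq> z" if "A \<noteq> {}" using x2 A' that by auto
    ultimately have "e \<in> path_uedges p" using e A' by auto
    then show "set p \<inter> {a, b, c} \<noteq> {}" using path_uedges_subset e x(1) by fast
  qed
  moreover have "F \<union> A \<union> path_uedges p = E" using AE unfolding F_def by blast
  ultimately show ?thesis using cW unfolding good_def by auto
qed

lemma reduce_path:
  assumes "distinct p" "path_uedges p \<subseteq> E" "2 \<le> length p" "u \<in> V" "v \<in> V" "u \<noteq> v"
    and "\<And>w. {u, w} \<in> E \<Longrightarrow> {u, w} \<in> path_uedges p"
    and "\<And>w. {v, w} \<in> E \<Longrightarrow> {v, w} \<in> path_uedges p"
  shows "good V E"
  by (rule reduce[of p u v "{}"]) (use assms in auto)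

lemma reduce_attach:
  assumes "distinct p" "2 \<le> length p" "path_uedges p \<subseteq> E" "u \<in> V" "v \<in> V" "u \<noteq> v"
    and "\<And>w. {u, w} \<in> E \<Longrightarrow> {u, w} \<in> insert {z, v} (path_uedges p)"
    and "\<And>w. {v, w} \<in> E \<Longrightarrow> {v, w} \<in> insert {z, v} (path_uedges p)"
    and "{z, v} \<in> E" "{z, v} \<notin> path_uedges p" "even (degr E z + degr (path_uedges p) z)"
  shows "good V E"
  using assms by (intro reduce[of p u v "{{z, v}}" z]) auto

end

section \<open>Two vertices of degree at most 2\<close>

lemma path_uedges_join:
  "xs \<noteq> [] \<Longrightarrow> ys \<noteq> [] \<Longrightarrow>
    path_uedges (xs @ ys) = insert {last xs, hd ys} (path_uedges xs \<union> path_uedges ys)"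
proof -
  assume "xs \<noteq> []" "ys \<noteq> []"
  then obtain xs' x y ys' where "xs = xs' @ [x]" "ys = y # ys'" by (metis neq_Nil_conv rev_exhaust)
  then show ?thesis by simp
qed

definition upath :: "'a set set \<Rightarrow> 'a list \<Rightarrow> bool" where
  "upath E p \<longleftrightarrow> p \<noteq> [] \<and> distinct p \<and> path_uedges p \<subseteq> E"

text \<open>The set serves both ways: a vertex inside it yields a path, and a vertex outside it
  yields a splitting of the graph, because no edge leaves the set.\<close>

lemma reachable_set:
  obtains X where "x \<in> X" "\<And>u w. u \<in> X \<Longrightarrow> {u, w} \<in> E \<Longrightarrow> w \<in> X"
    "\<And>w. w \<in> X \<Longrightarrow> \<exists>p. upath E p \<and> hd p = x \<and> last p = w"
proof
  define X where "X = {w. \<exists>p. upath E p \<and> hd p = x \<and> last p = w}"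
  show "x \<in> X" unfolding X_def upath_def by (auto intro!: exI[of _ "[x]"])
  show "\<exists>p. upath E p \<and> hd p = x \<and> last p = w" if "w \<in> X" for w using that unfolding X_def by blast
  fix u w assume "u \<in> X" and uw: "{u, w} \<in> E"
  then obtain p where p: "p \<noteq> []" "distinct p" "path_uedges p \<subseteq> E" "hd p = x" "last p = u"
    unfolding X_def upath_def by blast
  show "w \<in> X"
  proof (cases "w \<in> set p")
    case True
    then obtain q r where q: "p = q @ w # r" by (meson split_list)
    then have "upath E (q @ [w])" using p path_uedges_append[of q w r] unfolding upath_def by auto
    moreover have "hd (q @ [w]) = x" using p(4) q by (cases q) auto
    ultimately show ?thesis unfolding X_def by (intro CollectI exI[of _ "q @ [w]"]) simp
  next
    case False
    then have "upath E (p @ [w])" using p uw path_uedges_join[of p "[w]"] unfolding upath_def by simp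
    then show ?thesis unfolding X_def using p by (intro CollectI exI[of _ "p @ [w]"]) simp
  qed
qed

context induction_step
begin

lemma degr_card: "degr E v = card (nbrs E v)"
  using degr_nbrs[OF simple_graph] .

lemma nbrs_sym: "w \<in> nbrs E v \<longleftrightarrow> v \<in> nbrs E w"
  unfolding nbrs_def by (simp add: insert_commute)

lemma nbrs_V: "w \<in> nbrs E v \<Longrightarrow> w \<in> V \<and> v \<in> V \<and> w \<noteq> v"
  using ugraph_irrefl[OF simple_graph] unfolding nbrs_def by blast

lemma fin_nbrs: "finite (nbrs E v)"
  using finite_nbrs[OF simple_graph] .

lemma good_union:
  assumes "good X F" "good Y F'" "F \<inter> F' = {}" "F \<union> F' = E" "card X div 2 + card Y div 2 \<le> card V div 2"
  shows "good V E"
proof -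
  obtain k m where "k \<le> card X div 2" "decomposes F k" "m \<le> card Y div 2" "decomposes F' m"
    using assms(1,2) unfolding good_def by blast
  then show ?thesis using decomposes_union[of F k F' m] assms(3-5) unfolding good_def
    by (intro exI[of _ "k + m"]) simp
qed

lemma no_triangle_closed:
  assumes "F \<subseteq> E" "\<And>w. w \<in> \<Union> F \<Longrightarrow> degr F w = degr E w"
  shows "no_triangle_component F"
  unfolding no_triangle_component_def
proof (intro allI notI)
  fix a b c assume t: "triangle_component F a b c"
  then have "a \<in> \<Union> F" "b \<in> \<Union> F" "c \<in> \<Union> F" unfolding triangle_component_def triangle_def by auto
  then have "triangle_component E a b c" using t assms unfolding triangle_component_def by auto
  then show False using no_triangle unfolding no_triangle_component_def by blast
qed

text \<open>Both sides are smaller and keep all degrees, so the induction hypothesis covers each.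
  The two rounded halves add up to at most the rounded half of the sum.\<close>

lemma good_disconnected:
  assumes V: "X \<union> Y = V" "X \<inter> Y = {}" "X \<noteq> {}" "Y \<noteq> {}"
    and E: "\<And>e. e \<in> E \<Longrightarrow> e \<subseteq> X \<or> e \<subseteq> Y"
  shows "good V E"
proof -
  have f: "finite X" "finite Y" using V(1) fin(1) by auto
  then have c: "card V = card X + card Y" "0 < card X" "0 < card Y"
    using V card_Un_disjoint[of X Y] by (auto simp: card_gt_0_iff)
  have ne: "e \<noteq> {}" if "e \<in> E" for e using that simple_graph unfolding ugraph_def by fastforce
  have part: "good Z {e \<in> E. e \<subseteq> Z}"
    if Z: "Z \<subseteq> V" "card Z < card V" "\<And>e. e \<in> E \<Longrightarrow> e \<inter> Z = {} \<or> e \<subseteq> Z" for Z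
  proof (rule IH[OF Z(2)])
    show "two_degen Z {e \<in> E. e \<subseteq> Z}" by (rule two_degen_sub[OF degen Z(1)]) auto
    show "no_triangle_component {e \<in> E. e \<subseteq> Z}"
    proof (rule no_triangle_closed)
      fix w assume "w \<in> \<Union> {e \<in> E. e \<subseteq> Z}"
      then show "degr {e \<in> E. e \<subseteq> Z} w = degr E w" using Z(3) by (intro degr_cong) blast
    qed auto
  qed
  show ?thesis
  proof (rule good_union[of X "{e \<in> E. e \<subseteq> X}" Y "{e \<in> E. e \<subseteq> Y}"])
    show "good X {e \<in> E. e \<subseteq> X}" using V(1,2) c E by (intro part) fastforce+
    show "good Y {e \<in> E. e \<subseteq> Y}" using V(1,2) c E by (intro part) fastforce+
    show "{e \<in> E. e \<subseteq> X} \<inter> {e \<in> E. e \<subseteq> Y} = {}" using V(2) ne by blast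
    show "{e \<in> E. e \<subseteq> X} \<union> {e \<in> E. e \<subseteq> Y} = E" using E by blast
  qed (use c in linarith)
qed

lemma good_or_connected:
  assumes "x \<in> V" "w \<in> V"
  shows "good V E \<or> (\<exists>p. upath E p \<and> hd p = x \<and> last p = w)"
proof -
  obtain X where X: "x \<in> X" "\<And>u w. u \<in> X \<Longrightarrow> {u, w} \<in> E \<Longrightarrow> w \<in> X"
    "\<And>w. w \<in> X \<Longrightarrow> \<exists>p. upath E p \<and> hd p = x \<and> last p = w" by (rule reachable_set[where x = x and E = E]) blast
  show ?thesis
  proof (cases "w \<in> X")
    case False
    have "good V E"
    proof (rule good_disconnected[of "V \<inter> X" "V - X"])
      fix e assume e: "e \<in> E"
      then have eV: "e \<subseteq> V" using simple_graph unfolding ugraph_def by blast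
      show "e \<subseteq> V \<inter> X \<or> e \<subseteq> V - X"
      proof (cases "e \<inter> X = {}")
        case False
        then obtain u where u: "u \<in> e" "u \<in> X" by blast
        then obtain u' where "e = {u, u'}" using ugraph_edge[OF simple_graph e] by blast
        then show ?thesis using u X(2) e eV by blast
      qed (use eV in blast)
    qed (use assms X(1) False in blast)+
    then show ?thesis ..
  qed (use X(3) in blast)
qed

text \<open>A second neighbour of \<open>u\<close> further along the path would give a shortcut,
  against minimality. So \<open>xs\<close> can be put in front of the path, which then contains
  every edge at \<open>u\<close>.\<close>

lemma minimal_path_end:
  assumes p: "upath E (u # b # ps)" and deg: "degr E u \<le> 2"
    and min: "\<And>q. upath E q \<Longrightarrow> hd q = u \<Longrightarrow> last q = last (u # b # ps) \<Longrightarrow> length (u # b # ps) \<le> length q"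
  shows "\<exists>xs. (xs = [] \<or> (\<exists>a. xs = [a] \<and> a \<in> nbrs E u \<and> a \<notin> set (u # b # ps))) \<and> nbrs E u \<subseteq> insert b (set xs)"
proof -
  have b: "b \<in> nbrs E u" using p unfolding upath_def nbrs_def by simp
  show ?thesis
  proof (cases "nbrs E u = {b}")
    case False
    then obtain a where a: "a \<in> nbrs E u" "a \<noteq> b" using b by blast
    have "{a, b} = nbrs E u"
      using a b deg fin_nbrs[of u] unfolding degr_card by (intro card_seteq) auto
    moreover have "a \<notin> set (u # b # ps)"
    proof
      assume "a \<in> set (u # b # ps)"
      then have "a \<in> set ps" using a nbrs_V by auto
      then obtain q r where q: "ps = q @ a # r" by (meson split_list)
      have "path_uedges (a # r) \<subseteq> E"
        using p path_uedges_append[of "b # q" a r] q unfolding upath_def by auto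
      then have "upath E (u # a # r)" using p q a(1) unfolding upath_def nbrs_def by auto
      then have "length (u # b # ps) \<le> length (u # a # r)" using q by (intro min) auto
      then show False using q by simp
    qed
    ultimately show ?thesis using a by (intro exI[of _ "[a]"]) auto
  qed (auto intro: exI[of _ "[]"])
qed

text \<open>The remaining neighbours of \<open>u\<close> and \<open>w\<close> coincide in
  \<open>a\<close>, so \<open>{a, w}\<close> has no place on the path \<open>a # p\<close>. If
  \<open>a\<close> has odd degree, this edge is attached at the path end \<open>a\<close>. If the
  degree is even and at least 4, the path is first prolonged beyond \<open>a\<close>. If it is 2,
  either there is a triangle component or \<open>a\<close> is removed together with
  \<open>u\<close>.\<close>

lemma two_low_common_nbr:
  assumes p: "upath E (a # p)" "hd p = u" "last p = w" "2 \<le> length p" "length p \<le> 3"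
    and iso_u: "\<And>y. y \<in> nbrs E u \<Longrightarrow> {u, y} \<in> path_uedges (a # p)"
    and iso_w: "\<And>y. y \<in> nbrs E w \<Longrightarrow> y = a \<or> {w, y} \<in> path_uedges p"
    and a: "a \<in> nbrs E w"
  shows "good V E"
proof -
  \<comment> \<open>\<open>remdups_adj.cases\<close> serves to distinguish lists with no, one, and
    at least two elements.\<close>
  obtain ps where ps: "p = u # ps" "ps \<noteq> []" using p(2,4) by (cases p rule: remdups_adj.cases) auto
  have d: "distinct (a # p)" "path_uedges (a # p) \<subseteq> E" using p(1) unfolding upath_def by auto
  have pe: "path_uedges (a # p) = insert {a, u} (path_uedges p)" using ps by simp
  have w: "w \<in> set ps" "u \<noteq> w" using p(3) ps d by auto
  have aw: "{a, w} \<in> E" "w \<in> nbrs E a" using a unfolding nbrs_def by (simp_all add: insert_commute)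
  have au: "{a, u} \<in> E" "u \<in> nbrs E a" using d(2) unfolding pe nbrs_def by auto
  have V: "u \<in> V" "w \<in> V" "a \<in> V" using ugraph_irrefl[OF simple_graph] aw(1) au(1) by blast+
  have awn: "{a, w} \<notin> path_uedges (a # p)"
    unfolding pe using w d ps(1) path_uedges_subset[of "{a, w}" p] by (auto simp: doubleton_eq_iff)
  have iu: "{u, y} \<in> path_uedges (a # p)" if "{u, y} \<in> E" for y using iso_u that unfolding nbrs_def by blast
  have iw: "{w, y} \<in> insert {a, w} (path_uedges (a # p))" if "{w, y} \<in> E" for y
    using iso_w[of y] that unfolding nbrs_def pe by (auto simp: insert_commute)
  have two: "{u, w} \<subseteq> nbrs E a" "card {u, w} = 2" using au(2) aw(2) w by auto
  then have "2 \<le> degr E a" unfolding degr_card using card_mono[OF fin_nbrs] by metis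
  then have "odd (degr E a) \<or> degr E a = 2 \<or> even (degr E a) \<and> 4 \<le> degr E a" by presburger
  then consider "odd (degr E a)" | "degr E a = 2" | "even (degr E a)" "4 \<le> degr E a" by blast
  then show ?thesis
  proof cases
    case 1
    have "degr (path_uedges (a # p)) a = 1" using degr_path_uedges[OF d(1)] ps by simp
    then have "even (degr E a + degr (path_uedges (a # p)) a)" using 1 by simp
    then show ?thesis using iu p(4)
      by (intro reduce_attach[OF d(1) _ d(2) V(1,2) w(2) _ iw aw(1) awn]) auto
  next
    case 2
    then have na: "nbrs E a = {u, w}" using two fin_nbrs[of a] unfolding degr_card
      by (metis card_subset_eq)
    obtain y ys where y: "ps = y # ys" using ps by (cases ps) auto
    show ?thesis
    proof (cases ys)
      case Nil
      then have pw: "p = [u, w]" using y ps p(3) by simp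
      have uw: "{u, w} \<in> E" using d(2) unfolding pw by simp
      have pw2: "path_uedges (a # p) = {{a, u}, {u, w}}" "path_uedges p = {{u, w}}" unfolding pw by auto
      have "nbrs E u = {a, w}"
      proof (intro equalityI subsetI)
        fix y assume "y \<in> nbrs E u"
        then have "{u, y} = {a, u} \<or> {u, y} = {u, w}" using iso_u unfolding pw2 by blast
        then show "y \<in> {a, w}" by (auto simp: doubleton_eq_iff)
      qed (use au(1) uw in \<open>auto simp: nbrs_def insert_commute\<close>)
      moreover have "nbrs E w = {a, u}"
      proof (intro equalityI subsetI)
        fix y assume "y \<in> nbrs E w"
        then have "y = a \<or> {w, y} = {u, w}" using iso_w unfolding pw2 by blast
        then show "y \<in> {a, u}" by (auto simp: doubleton_eq_iff)
      qed (use aw(1) uw in \<open>auto simp: nbrs_def insert_commute\<close>)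
      ultimately have "triangle_component E a u w"
        using na d(1) uw au(1) aw(1) unfolding triangle_component_def triangle_def degr_card pw by simp
      then show ?thesis using no_triangle unfolding no_triangle_component_def by blast
    next
      case (Cons y' ys')
      then have pw: "p = [u, y, w]" using y ps p(3,5) by (cases ys') auto
      \<comment> \<open>The vertices form a 4-cycle, and three of its edges contain every edge at
        \<open>a\<close> and at \<open>u\<close>.\<close>
      have "distinct [w, a, u, y]" "path_uedges [w, a, u, y] \<subseteq> E"
        using d aw unfolding pw by (auto simp: insert_commute)
      then show ?thesis
      proof (rule reduce_path[of "[w, a, u, y]" a u])
        show "{a, x} \<in> path_uedges [w, a, u, y]" if "{a, x} \<in> E" for x
        proof -
          have "x \<in> nbrs E a" using that unfolding nbrs_def by simp
          then have "x = u \<or> x = w" using na by blast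
          then show ?thesis by (auto simp: insert_commute)
        qed
        show "{u, x} \<in> path_uedges [w, a, u, y]" if "{u, x} \<in> E" for x
          using iu[OF that] d(1) unfolding pw by (auto simp: insert_commute doubleton_eq_iff)
      qed (use V d(1) ps in auto)
    qed
  next
    case 3
    \<comment> \<open>The length bound on \<open>p\<close> is what leaves a neighbour
      \<open>r\<close> of \<open>a\<close> outside \<open>p\<close>.\<close>
    have "card (set p) \<le> 3" using p(5) card_length[of p] by linarith
    then have "\<not> nbrs E a \<subseteq> set p" using 3(2) card_mono[of "set p" "nbrs E a"] unfolding degr_card by auto
    then obtain r where r: "r \<in> nbrs E a" "r \<notin> set p" by blast
    have ra: "{r, a} \<in> E" "r \<noteq> a" using r(1) nbrs_V[of r a] unfolding nbrs_def by (auto simp: insert_commute)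
    have dr: "distinct (r # a # p)" using d(1) r ra by simp
    have per: "path_uedges (r # a # p) = insert {r, a} (path_uedges (a # p))" by simp
    have "degr (path_uedges (r # a # p)) a = 2"
      using degr_path_uedges[OF dr] dr ps p(3) w by auto
    then have ev: "even (degr E a + degr (path_uedges (r # a # p)) a)" using 3(1) by simp
    have "{a, w} \<noteq> {r, a}" using r(2) w ps by (auto simp: doubleton_eq_iff)
    then have nin: "{a, w} \<notin> path_uedges (r # a # p)" using awn unfolding per by simp
    show ?thesis
    proof (rule reduce_attach[OF dr _ _ V(1,2) w(2) _ _ aw(1) nin ev])
      show "path_uedges (r # a # p) \<subseteq> E" unfolding per using d(2) ra(1) by simp
      show "{u, x} \<in> insert {a, w} (path_uedges (r # a # p))" if "{u, x} \<in> E" for x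
        unfolding per using iu[OF that] by simp
      show "{w, x} \<in> insert {a, w} (path_uedges (r # a # p))" if "{w, x} \<in> E" for x
        unfolding per using iw[OF that] by blast
    qed simp
  qed
qed

text \<open>A shortest path between the two vertices, prolonged at each end by the remaining
  neighbour if there is one, contains all edges at \<open>u\<close> and \<open>w\<close>. The
  prolonged list repeats a vertex only if the two added ones coincide.\<close>

lemma two_low:
  assumes "u \<in> V" "w \<in> V" "u \<noteq> w" "degr E u \<le> 2" "degr E w \<le> 2"
  shows "good V E"
proof -
  define P where "P p \<longleftrightarrow> upath E p \<and> hd p = u \<and> last p = w" for p
  have sym: "upath E (rev q)" if "upath E q" for q using that unfolding upath_def by simp
  consider "good V E" | p0 where "P p0" using good_or_connected[OF assms(1,2)] unfolding P_def by blast
  then show ?thesis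
  proof cases
    case 2
    obtain p where p: "P p" "\<And>q. P q \<Longrightarrow> length p \<le> length q"
      using ex_has_least_nat[of P p0 length] 2 by blast
    have pp: "upath E p" "hd p = u" "last p = w" "p \<noteq> []" using p(1) unfolding P_def upath_def by auto
    obtain b ps where pb: "p = u # b # ps" using pp assms(3) by (cases p rule: remdups_adj.cases) auto
    \<comment> \<open>The end \<open>w\<close> is handled as the start of the reversed path.\<close>
    have "rev p \<noteq> []" "hd (rev p) = w" "last (rev p) = u" using pp by (simp_all add: hd_rev last_rev)
    then obtain c qs where pc: "rev p = w # c # qs" using assms(3) by (cases "rev p" rule: remdups_adj.cases) auto
    have "\<exists>xs. (xs = [] \<or> (\<exists>a. xs = [a] \<and> a \<in> nbrs E u \<and> a \<notin> set (u # b # ps))) \<and> nbrs E u \<subseteq> insert b (set xs)"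
      by (rule minimal_path_end) (use pp p(2) pb assms(4) P_def in auto)
    then obtain xs where xs: "xs = [] \<or> (\<exists>a. xs = [a] \<and> a \<in> nbrs E u \<and> a \<notin> set p)" "nbrs E u \<subseteq> insert b (set xs)"
      unfolding pb by blast
    have lr: "length (w # c # qs) = length p" "last (w # c # qs) = u"
      using pp unfolding pc[symmetric] by (simp_all add: last_rev)
    have "\<exists>ys. (ys = [] \<or> (\<exists>a. ys = [a] \<and> a \<in> nbrs E w \<and> a \<notin> set (w # c # qs))) \<and> nbrs E w \<subseteq> insert c (set ys)"
    proof (rule minimal_path_end)
      show "upath E (w # c # qs)" using sym[OF pp(1)] pc by simp
      fix q assume q: "upath E q" "hd q = w" "last q = last (w # c # qs)"
      then have "P (rev q)" using sym lr(2) unfolding P_def by (simp add: hd_rev last_rev upath_def)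
      then show "length (w # c # qs) \<le> length q" using p(2)[of "rev q"] lr(1) by simp
    qed (rule assms(5))
    then obtain ys where ys: "ys = [] \<or> (\<exists>a. ys = [a] \<and> a \<in> nbrs E w \<and> a \<notin> set p)" "nbrs E w \<subseteq> insert c (set ys)"
      unfolding pc[symmetric] by auto
    have ub: "{u, b} \<in> path_uedges p" unfolding pb by simp
    have wc: "{w, c} \<in> path_uedges p" using path_uedges_rev[of p] unfolding pc by auto
    show ?thesis
    proof (cases "xs \<noteq> [] \<and> xs = ys")
      case True
      then obtain a where a: "xs = [a]" "ys = [a]" "a \<in> nbrs E u" "a \<in> nbrs E w" "a \<notin> set p" using xs ys by auto
      have au: "{a, u} \<in> E" "{u, a} \<in> E" "{a, w} \<in> E" "{u, a} \<in> E"
        using a(3,4) unfolding nbrs_def by (simp_all add: insert_commute)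
      have "a \<noteq> u" "a \<noteq> w" using a(5) pp by (auto simp: hd_in_set last_in_set)
      \<comment> \<open>The way over the common neighbour bounds the length of the shortest path, as
        \<open>two_low_common_nbr\<close> requires.\<close>
      then have "P [u, a, w]" using au assms(3) unfolding P_def upath_def by auto
      then have "length p \<le> 3" using p(2) by fastforce
      then show ?thesis
      proof (rule two_low_common_nbr[of a p u w, rotated 4])
        show "upath E (a # p)" using pp a(5) au unfolding upath_def pb by auto
        show "{u, y} \<in> path_uedges (a # p)" if "y \<in> nbrs E u" for y
          using that xs(2) a(1) ub unfolding pb by (auto simp: insert_commute)
        show "y = a \<or> {w, y} \<in> path_uedges p" if "y \<in> nbrs E w" for y
          using that ys(2) a(2) wc by auto
      qed (use pp a pb in auto)
    next
      case False
      then have dis: "set xs \<inter> set ys = {}" using xs(1) ys(1) by auto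
      let ?q = "xs @ p @ ys"
      have pe: "path_uedges ?q = (if xs = [] then {} else {{hd xs, u}}) \<union> path_uedges p \<union> (if ys = [] then {} else {{w, hd ys}})"
      proof -
        have "path_uedges (p @ ys) = path_uedges p \<union> (if ys = [] then {} else {{w, hd ys}})"
          using ys(1) pp(3,4) path_uedges_join[of p ys] by (cases "ys = []") auto
        moreover have "path_uedges ?q = (if xs = [] then {} else {{hd xs, u}}) \<union> path_uedges (p @ ys)"
          using xs(1) pp(2,4) path_uedges_join[of xs "p @ ys"] by (cases "xs = []") auto
        ultimately show ?thesis by (simp only: Un_assoc)
      qed
      show ?thesis
      proof (rule reduce_path[of ?q u w])
        show "distinct ?q" using xs(1) ys(1) dis pp(1) unfolding upath_def by auto
        show "path_uedges ?q \<subseteq> E" unfolding pe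
          using xs(1) ys(1) pp(1) unfolding upath_def nbrs_def by (auto simp: insert_commute)
        show "{u, y} \<in> path_uedges ?q" if "{u, y} \<in> E" for y
        proof -
          have "y = b \<or> y \<in> set xs" using that xs(2) unfolding nbrs_def by auto
          then show ?thesis unfolding pe using ub xs(1) by (auto simp: insert_commute)
        qed
        show "{w, y} \<in> path_uedges ?q" if "{w, y} \<in> E" for y
        proof -
          have "y = c \<or> y \<in> set ys" using that ys(2) unfolding nbrs_def by auto
          then show ?thesis unfolding pe using wc ys(1) by auto
        qed
        show "2 \<le> length ?q" unfolding pb by simp
      qed (use assms in auto)
    qed
  qed
qed

end

section \<open>Bridges\<close>

locale counterexample = induction_step +
  assumes not_good: "\<not> good V E"
begin

lemma low_unique: "u \<in> V \<Longrightarrow> w \<in> V \<Longrightarrow> degr E u \<le> 2 \<Longrightarrow> degr E w \<le> 2 \<Longrightarrow> u = w"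
  using two_low not_good by blast

lemma edge_V: "e \<in> E \<Longrightarrow> e \<subseteq> V \<and> e \<noteq> {}"
  using simple_graph unfolding ugraph_def by fastforce

text \<open>At least two corners of a triangle component differ from \<open>z\<close> and so have
  degree 2 in \<open>E\<close> as well, against \<open>low_unique\<close>.\<close>

lemma no_triangle_one:
  assumes "F \<subseteq> E" "\<And>w. w \<in> \<Union> F \<Longrightarrow> w \<noteq> z \<Longrightarrow> degr F w = degr E w"
  shows "no_triangle_component F"
  unfolding no_triangle_component_def
proof (intro allI notI)
  fix a b c assume t: "triangle_component F a b c"
  have F: "a \<in> \<Union> F" "b \<in> \<Union> F" "c \<in> \<Union> F" using t unfolding triangle_component_def triangle_def by auto
  then have V: "a \<in> V" "b \<in> V" "c \<in> V" using assms(1) edge_V by blast+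
  have d: "a \<noteq> b" "b \<noteq> c" "a \<noteq> c" "degr F a = 2" "degr F b = 2" "degr F c = 2"
    using t unfolding triangle_component_def by auto
  have l: "w = z \<or> degr E w \<le> 2" if "w \<in> \<Union> F" "degr F w = 2" for w
    by (cases "w = z") (use assms(2)[OF that(1)] that(2) in simp_all)
  consider "a \<noteq> z" "b \<noteq> z" | "a \<noteq> z" "c \<noteq> z" | "b \<noteq> z" "c \<noteq> z" using d by blast
  then show False
  proof cases
    case 1
    then show False using l[OF F(1) d(4)] l[OF F(2) d(5)] low_unique[OF V(1,2)] d(1) by blast
  next
    case 2
    then show False using l[OF F(1) d(4)] l[OF F(3) d(6)] low_unique[OF V(1,3)] d(3) by blast
  next
    case 3
    then show False using l[OF F(2) d(5)] l[OF F(3) d(6)] low_unique[OF V(2,3)] d(2) by blast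
  qed
qed

text \<open>Within \<open>X\<close> only \<open>x\<close> loses an edge, so
  \<open>no_triangle_one\<close> excludes triangle components.\<close>

lemma good_side:
  assumes V: "X \<union> Y = V" "X \<inter> Y = {}" and xv: "x \<in> X" "v \<in> Y"
    and E: "\<And>e. e \<in> E \<Longrightarrow> e = {x, v} \<or> e \<subseteq> X \<or> e \<subseteq> Y"
  shows "good X {e \<in> E. e \<subseteq> X}"
proof (rule IH)
  show "card X < card V" using V xv fin(1) by (intro psubset_card_mono) auto
  show "two_degen X {e \<in> E. e \<subseteq> X}" by (rule two_degen_sub[OF degen]) (use V in auto)
  show "no_triangle_component {e \<in> E. e \<subseteq> X}"
  proof (rule no_triangle_one[where z = x])
    fix w assume w: "w \<in> \<Union> {e \<in> E. e \<subseteq> X}" "w \<noteq> x"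
    then have wX: "w \<in> X" by blast
    have "e \<subseteq> X" if "e \<in> E" "w \<in> e" for e using E[OF that(1)] that(2) wX w(2) V xv by auto
    then show "degr {e \<in> E. e \<subseteq> X} w = degr E w" by (intro degr_cong) blast
  qed auto
qed

text \<open>Since \<open>card X\<close> is even, the pendant vertex \<open>v\<close> can be added to the side \<open>X\<close> for free.\<close>
lemma no_even_bridge:
  assumes V: "X \<union> Y = V" "X \<inter> Y = {}" and xv: "x \<in> X" "v \<in> Y" "{x, v} \<in> E"
    and E: "\<And>e. e \<in> E \<Longrightarrow> e = {x, v} \<or> e \<subseteq> X \<or> e \<subseteq> Y"
    and c: "2 \<le> card Y" "even (card X)"
  shows False
proof -
  let ?F = "insert {x, v} {e \<in> E. e \<subseteq> X}" and ?F' = "{e \<in> E. e \<subseteq> Y}"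
  have f: "finite X" "finite Y" using V(1) fin(1) by auto
  have cV: "card V = card X + card Y" using V card_Un_disjoint[OF f] by simp
  have vX: "v \<notin> X" "x \<notin> Y" using V(2) xv by auto
  have cU: "card (insert v X) = Suc (card X)" using vX f by simp
  have F: "good (insert v X) ?F"
  proof (rule IH)
    \<comment> \<open>Here \<open>2 \<le> card Y\<close> matters: some vertex must remain outside
      \<open>insert v X\<close>.\<close>
    show "card (insert v X) < card V" using cU cV c by simp
    show "two_degen (insert v X) ?F" by (rule two_degen_sub[OF degen]) (use V xv in auto)
    show "no_triangle_component ?F"
    proof (rule no_triangle_one[where z = v])
      fix w assume w: "w \<in> \<Union> ?F" "w \<noteq> v"
      then have wX: "w \<in> X" using xv by auto
      have "e \<in> ?F" if "e \<in> E" "w \<in> e" for e using E[OF that(1)] that wX V(2) by auto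
      then show "degr ?F w = degr E w" using xv(3) by (intro degr_cong) blast
    qed (use xv in auto)
  qed
  have F': "good Y ?F'"
  proof (rule good_side[of Y X v x])
    show "Y \<union> X = V" "Y \<inter> X = {}" using V by auto
    show "e = {v, x} \<or> e \<subseteq> Y \<or> e \<subseteq> X" if "e \<in> E" for e using E[OF that] by (auto simp: insert_commute)
  qed (use xv in auto)
  have "good V E"
  proof (rule good_union[OF F F'])
    show "?F \<inter> ?F' = {}" using V(2) vX edge_V by blast
    show "?F \<union> ?F' = E" using E xv(3) by blast
    show "card (insert v X) div 2 + card Y div 2 \<le> card V div 2" using c(2) unfolding cU cV by auto
  qed
  then show False using not_good by blast
qed

text \<open>By \<open>no_even_bridge\<close> both sides have odd size. The two roundings together
  then leave one path to spare, and the bridge itself takes it.\<close>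

lemma no_bridge:
  assumes V: "X \<union> Y = V" "X \<inter> Y = {}" and xv: "x \<in> X" "v \<in> Y" "{x, v} \<in> E"
    and E: "\<And>e. e \<in> E \<Longrightarrow> e = {x, v} \<or> e \<subseteq> X \<or> e \<subseteq> Y"
    and c: "2 \<le> card X" "2 \<le> card Y"
  shows False
proof -
  have V': "Y \<union> X = V" "Y \<inter> X = {}" using V by auto
  have vx: "{v, x} \<in> E" using xv(3) by (simp add: insert_commute)
  have E': "e = {v, x} \<or> e \<subseteq> Y \<or> e \<subseteq> X" if "e \<in> E" for e using E[OF that] by (auto simp: insert_commute)
  have "odd (card X)" using no_even_bridge[OF V xv E c(2)] by blast
  moreover have "odd (card Y)" using no_even_bridge[OF V' xv(2,1) vx E' c(1)] by blast
  moreover have "finite X" "finite Y" using V(1) fin(1) by auto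
  then have "card V = card X + card Y" using card_Un_disjoint[of X Y] V by simp
  moreover have "m div 2 + n div 2 + 1 = (m + n) div 2" if "odd m" "odd n" for m n :: nat
    using that by (auto elim!: oddE)
  ultimately have cV: "card X div 2 + card Y div 2 + 1 = card V div 2" by simp
  obtain k where k: "k \<le> card X div 2" "decomposes {e \<in> E. e \<subseteq> X} k"
    using good_side[OF V xv(1,2) E] unfolding good_def by blast
  obtain m where m: "m \<le> card Y div 2" "decomposes {e \<in> E. e \<subseteq> Y} m"
    using good_side[OF V' xv(2,1) E'] unfolding good_def by blast
  have xy: "x \<noteq> v" "x \<notin> Y" "v \<notin> X" using V(2) xv by auto
  have "decomposes ({e \<in> E. e \<subseteq> X} \<union> {e \<in> E. e \<subseteq> Y}) (k + m)"
    using V(2) edge_V by (intro decomposes_union[OF k(2) m(2)]) blast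
  then have "decomposes (path_uedges [x, v] \<union> ({e \<in> E. e \<subseteq> X} \<union> {e \<in> E. e \<subseteq> Y})) (Suc (k + m))"
    by (rule decomposes_path) (use xy in auto)
  moreover have "path_uedges [x, v] \<union> ({e \<in> E. e \<subseteq> X} \<union> {e \<in> E. e \<subseteq> Y}) = E"
    using E xv(3) by (simp, blast)
  ultimately have "good V E" using k(1) m(1) cV unfolding good_def by (intro exI[of _ "Suc (k + m)"]) simp
  then show False using not_good by blast
qed

text \<open>Otherwise \<open>{x, v}\<close> is a bridge between the set reachable from
  \<open>x\<close> without it and the complement. The vertices \<open>a\<close> and \<open>s\<close>
  ensure that both sides have at least two elements.\<close>

lemma path_avoiding_edge:
  assumes xv: "{x, v} \<in> E" and nb: "a \<in> nbrs E x" "a \<noteq> v" "s \<in> nbrs E v" "s \<noteq> x"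
  obtains p where "upath (E - {{x, v}}) p" "hd p = x" "last p = v"
proof -
  define D where "D = E - {{x, v}}"
  obtain X where X: "x \<in> X" "\<And>u w. u \<in> X \<Longrightarrow> {u, w} \<in> D \<Longrightarrow> w \<in> X"
    "\<And>w. w \<in> X \<Longrightarrow> \<exists>p. upath D p \<and> hd p = x \<and> last p = w"
    by (rule reachable_set[where x = x and E = D]) blast
  have "v \<in> X"
  proof (rule ccontr)
    assume v: "v \<notin> X"
    have V: "x \<in> V" "v \<in> V" "a \<in> V" "s \<in> V" "a \<noteq> x" "s \<noteq> v"
      using ugraph_irrefl[OF simple_graph xv] nbrs_V[OF nb(1)] nbrs_V[OF nb(3)] by simp_all
    have "{x, a} \<in> D" using nb(1,2) unfolding D_def nbrs_def by (auto simp: doubleton_eq_iff)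
    then have aX: "a \<in> X" by (rule X(2)[OF X(1)])
    have "{s, v} \<in> D"
      using nb(3,4) unfolding D_def nbrs_def by (auto simp: doubleton_eq_iff insert_commute)
    then have sX: "s \<notin> X" using X(2) v by blast
    show False
    proof (rule no_bridge[of "V \<inter> X" "V - X" x v])
      have "card {x, a} = 2" "{x, a} \<subseteq> V \<inter> X" using V aX X(1) by auto
      then show "2 \<le> card (V \<inter> X)" using card_mono[of "V \<inter> X" "{x, a}"] fin(1) by simp
      have "card {s, v} = 2" "{s, v} \<subseteq> V - X" using V sX v by auto
      then show "2 \<le> card (V - X)" using card_mono[of "V - X" "{s, v}"] fin(1) by simp
      fix e assume e: "e \<in> E"
      show "e = {x, v} \<or> e \<subseteq> V \<inter> X \<or> e \<subseteq> V - X"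
      proof (cases "e = {x, v} \<or> e \<inter> X = {}")
        case False
        then obtain u where u: "u \<in> e" "u \<in> X" by blast
        then obtain u' where u': "e = {u, u'}" using ugraph_edge[OF simple_graph e] by blast
        moreover have "e \<in> D" using e False unfolding D_def by simp
        ultimately have "u' \<in> X" using X(2)[OF u(2), of u'] by simp
        then show ?thesis using edge_V[OF e] u(2) unfolding u' by simp
      qed (use edge_V[OF e] in blast)
    qed (use V X(1) v xv in auto)
  qed
  from X(3)[OF this] obtain p where "upath D p" "hd p = x" "last p = v" by (elim exE conjE)
  then show ?thesis using that unfolding D_def by simp
qed

text \<open>The path pays for \<open>s\<close> and \<open>v\<close>. The only edge at these two that
  is off the path is \<open>{x, v}\<close>, and it is attached at \<open>x\<close>.\<close>

lemma attach_low:
  assumes nv: "nbrs E v = {s, x, y}" and p: "distinct p" "path_uedges p \<subseteq> E"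
    and e: "{s, v} \<in> path_uedges p" "{v, y} \<in> path_uedges p" "{x, v} \<notin> path_uedges p"
    and ns: "\<And>w. w \<in> nbrs E s \<Longrightarrow> {s, w} \<in> path_uedges p"
    and par: "even (degr E x + degr (path_uedges p) x)"
  shows False
proof -
  have len: "2 \<le> length p" using e(1) by (cases p rule: remdups_adj.cases) auto
  have s: "s \<in> V" "v \<in> V" "s \<noteq> v" using nbrs_V[of s v] nv by auto
  have "x \<in> nbrs E v" using nv by simp
  then have xv: "{x, v} \<in> E" unfolding nbrs_def by (simp add: insert_commute)
  have "good V E"
  proof (rule reduce_attach[OF p(1) len p(2) s _ _ xv e(3) par])
    show "{s, w} \<in> insert {x, v} (path_uedges p)" if "{s, w} \<in> E" for w
      using ns[of w] that unfolding nbrs_def by simp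
    fix w assume "{v, w} \<in> E"
    then have "w \<in> nbrs E v" unfolding nbrs_def by simp
    then have "w = s \<or> w = x \<or> w = y" using nv by blast
    then show "{v, w} \<in> insert {x, v} (path_uedges p)" using e(1,2) by (auto simp: insert_commute)
  qed
  then show False using not_good by blast
qed

text \<open>Here \<open>s\<close>, \<open>v\<close>, \<open>b\<close> form a triangle. The path
  \<open>x\<close>, \<open>v\<close>, \<open>s\<close>, \<open>b\<close> leaves out only
  \<open>{b, v}\<close>, which is attached at \<open>b\<close>. If \<open>b\<close> has even degree,
  the path runs one edge beyond \<open>b\<close> to correct the parity.\<close>

lemma low_triangle:
  assumes nv: "nbrs E v = {s, b, x}" and ns: "nbrs E s = {v, b}"
    and d: "s \<noteq> x" "s \<noteq> b" "b \<noteq> x" and b: "3 \<le> degr E b"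
  shows False
proof -
  have ne: "s \<noteq> v" "b \<noteq> v" "x \<noteq> v" using nbrs_V[of _ v] nv by auto
  have "s \<in> nbrs E v" "x \<in> nbrs E v" "b \<in> nbrs E s" using nv ns by auto
  then have e: "{v, s} \<in> E" "{v, x} \<in> E" "{s, b} \<in> E" unfolding nbrs_def by auto
  show False
  proof (cases "odd (degr E b)")
    case True
    let ?p = "[x, v, s, b]"
    have dp: "distinct ?p" using d ne by auto
    show False
    proof (rule attach_low[OF nv dp])
      show "even (degr E b + degr (path_uedges ?p) b)"
        using True degr_path_uedges[OF dp, of b] by simp
      show "{b, v} \<notin> path_uedges ?p" using d ne by (auto simp: doubleton_eq_iff)
      show "{s, w} \<in> path_uedges ?p" if "w \<in> nbrs E s" for w using that ns by (auto simp: insert_commute)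
    qed (use e in \<open>auto simp: insert_commute\<close>)
  next
    case False
    then have "4 \<le> card (nbrs E b)" using b unfolding degr_card by presburger
    moreover have "card {s, v, x} \<le> 3" by (simp add: card_insert_if)
    ultimately have "\<not> nbrs E b \<subseteq> {s, v, x}" using card_mono[of "{s, v, x}" "nbrs E b"] by auto
    then obtain r where r: "r \<in> nbrs E b" "r \<noteq> s" "r \<noteq> v" "r \<noteq> x" by blast
    have rb: "r \<noteq> b" "{b, r} \<in> E" using nbrs_V[OF r(1)] r(1) unfolding nbrs_def by auto
    let ?p = "[x, v, s, b, r]"
    have dp: "distinct ?p" using d ne r rb by auto
    show False
    proof (rule attach_low[OF nv dp])
      show "even (degr E b + degr (path_uedges ?p) b)"
        using False degr_path_uedges[OF dp, of b] d rb by simp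
      show "{b, v} \<notin> path_uedges ?p" using d ne r by (auto simp: doubleton_eq_iff)
      show "{s, w} \<in> path_uedges ?p" if "w \<in> nbrs E s" for w using that ns by (auto simp: insert_commute)
    qed (use e rb in \<open>auto simp: insert_commute\<close>)
  qed
qed

end

section \<open>A single vertex of degree at most 2\<close>

context counterexample
begin

text \<open>As an end of the path, \<open>x\<close> has degree 1 on it, so odd degree in
  \<open>E\<close> gives the parity that \<open>attach_low\<close> asks for.\<close>

lemma attach_low_end:
  assumes "nbrs E v = {s, x, y}" "distinct p" "path_uedges p \<subseteq> E"
    and e: "{s, v} \<in> path_uedges p" "{v, y} \<in> path_uedges p" "{x, v} \<notin> path_uedges p"
    and "\<And>w. w \<in> nbrs E s \<Longrightarrow> {s, w} \<in> path_uedges p"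
    and x: "hd p = x \<or> last p = x" "odd (degr E x)"
  shows False
proof (rule attach_low[OF assms(1-7)])
  have len: "2 \<le> length p" using e(1) by (cases p rule: remdups_adj.cases) auto
  then have "x \<in> set p" using x(1) by (cases p) auto
  then have "degr (path_uedges p) x = 1" using degr_path_uedges[OF assms(2) len, of x] x(1) by auto
  then show "even (degr E x + degr (path_uedges p) x)" using x(2) by simp
qed

text \<open>
  The list \<open>bs\<close> is empty if \<open>s\<close> is a leaf; otherwise it contains the neighbour of \<open>s\<close> other than \<open>v\<close>.
\<close>
definition fork :: "'a \<Rightarrow> 'a list \<Rightarrow> 'a \<Rightarrow> 'a \<Rightarrow> 'a \<Rightarrow> bool" where
  "fork v bs s x y \<longleftrightarrow> nbrs E v = {s, x, y} \<and> x \<noteq> y \<and> s \<noteq> x \<and> s \<noteq> y \<and>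
     (bs = [] \<or> (\<exists>b. bs = [b] \<and> b \<notin> {v, x, y})) \<and> nbrs E s = insert v (set bs)"

lemma fork_commute: "fork v bs s x y \<Longrightarrow> fork v bs s y x"
  unfolding fork_def by auto

lemma forkD:
  assumes "fork v bs s x y"
  shows "v \<noteq> s" "v \<noteq> x" "v \<noteq> y" "{s, v} \<in> E" "{v, s} \<in> E" "{v, x} \<in> E" "{v, y} \<in> E" "distinct (bs @ [s, v, y])"
    "path_uedges (bs @ [s]) \<subseteq> E" "x \<notin> set (bs @ [s, v, y])"
    "\<And>w. w \<in> nbrs E s \<Longrightarrow> {s, w} \<in> insert {s, v} (path_uedges (bs @ [s]))"
proof -
  have nv: "s \<in> nbrs E v" "x \<in> nbrs E v" "y \<in> nbrs E v" using assms unfolding fork_def by simp_all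
  show ne: "v \<noteq> s" "v \<noteq> x" "v \<noteq> y" using nbrs_V nv by metis+
  show "{v, s} \<in> E" "{v, x} \<in> E" "{v, y} \<in> E" using nv unfolding nbrs_def by simp_all
  then show "{s, v} \<in> E" by (simp add: insert_commute)
  have d: "x \<noteq> y" "s \<noteq> x" "s \<noteq> y" "nbrs E s = insert v (set bs)" using assms unfolding fork_def by blast+
  have "bs = [] \<or> (\<exists>b. bs = [b] \<and> b \<notin> {v, x, y} \<and> b \<noteq> s \<and> {b, s} \<in> E)"
  proof (cases "bs = []")
    case False
    then obtain b where b: "bs = [b]" "b \<notin> {v, x, y}" using assms unfolding fork_def by blast
    then have "b \<in> nbrs E s" using d(4) by simp
    then have "b \<noteq> s" "{b, s} \<in> E" using nbrs_V[of b s] unfolding nbrs_def by (auto simp: insert_commute)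
    then show ?thesis using b by blast
  qed simp
  then show "distinct (bs @ [s, v, y])" "path_uedges (bs @ [s]) \<subseteq> E" "x \<notin> set (bs @ [s, v, y])"
    "\<And>w. w \<in> nbrs E s \<Longrightarrow> {s, w} \<in> insert {s, v} (path_uedges (bs @ [s]))"
    using d ne by (auto simp: insert_commute)
qed

text \<open>If the degree were even, \<open>{x, v}\<close> could be attached to the path
  \<open>bs @ [s, v, y]\<close>, which misses \<open>x\<close>. By \<open>fork_commute\<close> this
  also applies to \<open>y\<close>.\<close>

lemma fork_odd:
  assumes f: "fork v bs s x y"
  shows "odd (degr E x)"
proof
  assume ev: "even (degr E x)"
  let ?p = "bs @ [s, v, y]"
  have pe: "path_uedges ?p = path_uedges (bs @ [s]) \<union> {{s, v}, {v, y}}" by simp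
  have nx: "{x, v} \<notin> path_uedges ?p" using path_uedges_subset[of "{x, v}" ?p] forkD(10)[OF f] by blast
  have "degr (path_uedges ?p) x = 0" using degr_path_uedges[OF forkD(8)[OF f], of x] forkD(10)[OF f] by simp
  then have "even (degr E x + degr (path_uedges ?p) x)" using ev by simp
  then show False
  proof (rule attach_low[OF _ forkD(8)[OF f] _ _ _ nx, rotated 5])
    show "nbrs E v = {s, x, y}" using f unfolding fork_def by blast
    show "path_uedges ?p \<subseteq> E" unfolding pe using forkD(4,7,9)[OF f] by simp
    show "{s, w} \<in> path_uedges ?p" if "w \<in> nbrs E s" for w unfolding pe using forkD(11)[OF f that] by blast
  qed (auto simp: pe)
qed

text \<open>The path from \<open>x\<close> to \<open>s\<close> enters \<open>s\<close> by its second
  edge; continued along \<open>v\<close>, \<open>y\<close> it leaves out only \<open>{x, v}\<close>.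
  If it already visits \<open>y\<close>, its part from \<open>y\<close> on, continued from
  \<open>s\<close> along \<open>v\<close>, \<open>x\<close>, does the same with \<open>x\<close> and
  \<open>y\<close> exchanged.\<close>

lemma fork_via_s:
  assumes f: "fork v bs s x y" and q: "distinct (q @ [s])" "v \<notin> set q" "path_uedges (q @ [s]) \<subseteq> E" "q \<noteq> []" "hd q = x"
  shows False
proof -
  have nv: "nbrs E v = {s, x, y}" "nbrs E v = {s, y, x}" and d: "x \<noteq> y" "s \<noteq> x" "s \<noteq> y"
    using f unfolding fork_def by auto
  have nx: "e \<notin> path_uedges r" if "v \<in> e" "v \<notin> set r" for e r using that path_uedges_subset by fastforce
  \<comment> \<open>Besides \<open>v\<close>, the vertex \<open>s\<close> has at most the neighbour
    in \<open>bs\<close>, so this neighbour is the vertex before \<open>s\<close> on the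
    path.\<close>
  have "last q \<in> nbrs E s"
    using q(3,4) path_uedges_join[of q "[s]"] unfolding nbrs_def by (simp add: insert_commute)
  moreover have "last q \<noteq> v" using q(2,4) by auto
  ultimately have b: "bs = [last q]" "nbrs E s = {v, last q}" "last q \<notin> {v, x, y}"
    using f unfolding fork_def by auto
  show False
  proof (cases "y \<in> set q")
    case False
    let ?p = "q @ [s, v, y]"
    have pe: "path_uedges ?p = path_uedges (q @ [s]) \<union> {{s, v}, {v, y}}" by simp
    have ls: "{last q, s} \<in> path_uedges (q @ [s])" using q(4) path_uedges_join[of q "[s]"] by simp
    show False
    proof (rule attach_low_end[OF nv(1)])
      show "distinct ?p" using q(1,2) False forkD(1,3)[OF f] d by auto
      show "path_uedges ?p \<subseteq> E" unfolding pe using q(3) forkD(4,7)[OF f] by simp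
      show "{x, v} \<notin> path_uedges ?p" unfolding pe
        using nx[of "{x,v}" "q @ [s]"] q(2) d forkD(1-3)[OF f] by (auto simp: doubleton_eq_iff)
      show "{s, w} \<in> path_uedges ?p" if "w \<in> nbrs E s" for w
        unfolding pe using that b(2) ls by (auto simp: insert_commute)
      show "hd ?p = x \<or> last ?p = x" using q(4,5) by simp
      show "odd (degr E x)" by (rule fork_odd[OF f])
    qed (auto simp: pe)
  next
    case True
    then obtain A B where AB: "q = A @ y # B" by (meson split_list)
    define r where "r = y # B"
    have A: "A \<noteq> []" "x \<in> set A" using AB q(5) d(1) by (cases A; auto)+
    have r: "q = A @ r" "r \<noteq> []" "hd r = y" "last r = last q" using AB unfolding r_def by auto
    let ?p = "r @ [s, v, x]"
    have "path_uedges (q @ [s]) = path_uedges (A @ [y]) \<union> path_uedges (r @ [s])"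
      using path_uedges_append[of A y "B @ [s]"] unfolding AB r_def by simp
    then have rE: "path_uedges (r @ [s]) \<subseteq> E" using q(3) by blast
    have pe: "path_uedges ?p = path_uedges (r @ [s]) \<union> {{s, v}, {v, x}}" by simp
    have ls: "{last q, s} \<in> path_uedges (r @ [s])" using r path_uedges_join[of r "[s]"] by simp
    show False
    proof (rule attach_low_end[OF nv(2)])
      show "distinct ?p" using q(1,2) A(2) forkD(1,2)[OF f] d unfolding r(1) by auto
      show "path_uedges ?p \<subseteq> E" unfolding pe using rE forkD(4,6)[OF f] by simp
      show "{y, v} \<notin> path_uedges ?p" unfolding pe
        using nx[of "{y,v}" "r @ [s]"] q(2) d forkD(1-3)[OF f] unfolding r(1) by (auto simp: doubleton_eq_iff)
      show "{s, w} \<in> path_uedges ?p" if "w \<in> nbrs E s" for w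
        unfolding pe using that b(2) ls by (auto simp: insert_commute)
      show "hd ?p = y \<or> last ?p = y" using r by simp
      show "odd (degr E y)" by (rule fork_odd[OF fork_commute[OF f]])
    qed (auto simp: pe)
  qed
qed

text \<open>The path avoids \<open>s\<close>, so \<open>bs @ [s, v]\<close> can be put in front of
  its reversal, which ends at the odd vertex \<open>x\<close>. If the vertex in \<open>bs\<close>
  lies on the path, the path from \<open>x\<close> is left there towards \<open>s\<close>,
  \<open>v\<close>, \<open>y\<close>.\<close>

lemma fork_via_y:
  assumes f: "fork v bs s x y" and q: "distinct q" "v \<notin> set q" "path_uedges q \<subseteq> E" "q \<noteq> []" "hd q = x" "last q = y"
  shows False
proof -
  have nv: "nbrs E v = {s, x, y}" and d: "x \<noteq> y" "s \<noteq> x" "s \<noteq> y" using f unfolding fork_def by auto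
  have nx: "e \<notin> path_uedges r" if "v \<in> e" "v \<notin> set r" for e r using that path_uedges_subset by fastforce
  \<comment> \<open>As an inner vertex of \<open>q\<close>, \<open>s\<close> would have two
    neighbours on \<open>q\<close>, both different from \<open>v\<close>; it has at most one such
    neighbour.\<close>
  have sq: "s \<notin> set q"
  proof
    assume "s \<in> set q"
    then obtain A B where AB: "q = A @ s # B" by (meson split_list)
    have "A \<noteq> []" "B \<noteq> []" using AB q(5,6) d by auto
    then obtain A' a b B' where ab: "A = A' @ [a]" "B = b # B'" by (metis neq_Nil_conv rev_exhaust)
    then have "q = A' @ a # s # b # B'" using AB by simp
    then have e: "{a, s} \<in> E" "{s, b} \<in> E" "a \<noteq> b" "a \<noteq> v" "b \<noteq> v" using q(1-3) by auto
    then have "a \<in> nbrs E s" "b \<in> nbrs E s" unfolding nbrs_def by (auto simp: insert_commute)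
    then have "a \<in> set bs" "b \<in> set bs" using f e(4,5) unfolding fork_def by auto
    then show False using f e(3) unfolding fork_def by auto
  qed
  show False
  proof (cases "set bs \<inter> set q = {}")
    case True
    let ?p = "bs @ s # v # rev q"
    have "path_uedges ([v] @ rev q) = insert {v, y} (path_uedges q)"
      using q(4,6) by (subst path_uedges_join) (auto simp: hd_rev)
    then have pe: "path_uedges ?p = path_uedges (bs @ [s]) \<union> {{s, v}, {v, y}} \<union> path_uedges q" by simp
    show False
    proof (rule attach_low_end[OF nv])
      show "distinct ?p" using q(1,2) sq True forkD(8)[OF f] by auto
      show "path_uedges ?p \<subseteq> E" unfolding pe using q(3) forkD(4,7,9)[OF f] by simp
      have "{x, v} \<notin> path_uedges (bs @ [s])" using nx[of "{x,v}" "bs @ [s]"] forkD(8)[OF f] by auto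
      then show "{x, v} \<notin> path_uedges ?p" unfolding pe
        using nx[of "{x,v}" q] q(2) d forkD(1-3)[OF f] by (simp add: doubleton_eq_iff)
      show "{s, w} \<in> path_uedges ?p" if "w \<in> nbrs E s" for w
        unfolding pe using forkD(11)[OF f that] by blast
      show "hd ?p = x \<or> last ?p = x" using q(4,5) by (simp add: last_rev)
      show "odd (degr E x)" by (rule fork_odd[OF f])
    qed (simp_all only: pe Un_iff insert_iff simp_thms)
  next
    case False
    then obtain b where b: "bs = [b]" "b \<in> set q" "b \<notin> {v, x, y}" using f unfolding fork_def by auto
    obtain A B where AB: "q = A @ b # B" using b(2) by (meson split_list)
    have A: "A \<noteq> []" "hd A = x" using AB q(5) b(3) by (cases A; auto)+
    have B: "y \<in> set B" using AB q(6) b(3) by (cases B rule: rev_cases) auto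
    \<comment> \<open>Since \<open>y\<close> comes after \<open>b\<close> on \<open>q\<close>, it is
      still free to be the last vertex.\<close>
    let ?p = "(A @ [b]) @ [s, v, y]"
    have pe: "path_uedges ?p = path_uedges (A @ [b]) \<union> {{b, s}, {s, v}, {v, y}}" by simp
    have Ab: "path_uedges (A @ [b]) \<subseteq> E" using path_uedges_append[of A b B] q(3) unfolding AB by blast
    have bs: "{b, s} \<in> E" using forkD(9)[OF f] b(1) by simp
    show False
    proof (rule attach_low_end[OF nv])
      show "distinct ?p" using q(1,2) sq B forkD(1,3)[OF f] d b(3) unfolding AB by auto
      show "path_uedges ?p \<subseteq> E" unfolding pe using Ab bs forkD(4,7)[OF f] by simp
      have "{x, v} \<notin> path_uedges (A @ [b])" using nx[of "{x,v}" "A @ [b]"] q(2) unfolding AB by simp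
      then show "{x, v} \<notin> path_uedges ?p" unfolding pe
        using d b(3) forkD(1-3)[OF f] by (simp add: doubleton_eq_iff)
      show "{s, w} \<in> path_uedges ?p" if "w \<in> nbrs E s" for w
        using forkD(11)[OF f that] unfolding pe b(1) by (auto simp: insert_commute)
      show "hd ?p = x \<or> last ?p = x" using A by simp
      show "odd (degr E x)" by (rule fork_odd[OF f])
    qed (auto simp: pe)
  qed
qed

text \<open>A path from \<open>x\<close> to \<open>v\<close> that avoids the edge
  \<open>{x, v}\<close> reaches \<open>v\<close> through \<open>s\<close> or through
  \<open>y\<close>. The degree bound supplies the further neighbour of \<open>x\<close> that
  \<open>path_avoiding_edge\<close> requires.\<close>

lemma no_fork:
  assumes f: "fork v bs s x y" and x: "3 \<le> degr E x"
  shows False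
proof -
  have nv: "nbrs E v = {s, x, y}" and d: "s \<noteq> x" using f unfolding fork_def by auto
  have "\<not> nbrs E x \<subseteq> {v}" using x card_mono[of "{v}" "nbrs E x"] unfolding degr_card by auto
  then obtain a where a: "a \<in> nbrs E x" "a \<noteq> v" by blast
  have xv: "{x, v} \<in> E" using forkD(6)[OF f] by (simp add: insert_commute)
  have "s \<in> nbrs E v" using nv by simp
  then obtain p where p: "upath (E - {{x, v}}) p" "hd p = x" "last p = v"
    using path_avoiding_edge[OF xv a _ d] by blast
  define q where "q = butlast p"
  have pq: "p = q @ [v]" using p(1,3) unfolding q_def upath_def by (metis append_butlast_last_id)
  have q: "q \<noteq> []" "hd q = x" using p(2) forkD(2)[OF f] unfolding pq by (cases q; auto)+
  have q2: "distinct q" "v \<notin> set q" using p(1) unfolding upath_def pq by auto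
  have "insert {last q, v} (path_uedges q) \<subseteq> E - {{x, v}}"
    using p(1) path_uedges_join[of q "[v]"] q(1) unfolding upath_def pq by simp
  then have qE: "path_uedges q \<subseteq> E" "{last q, v} \<in> E" "last q \<noteq> x" by auto
  then have "last q \<in> nbrs E v" unfolding nbrs_def by (simp add: insert_commute)
  then consider "last q = s" | "last q = y" using nv qE(3) by blast
  then show False
  proof cases
    case 1
    then have qs: "q = butlast q @ [s]" using q(1) by (metis append_butlast_last_id)
    define r where "r = butlast q"
    have r: "q = r @ [s]" using qs unfolding r_def .
    show False
    proof (rule fork_via_s[OF f])
      show "distinct (r @ [s])" "path_uedges (r @ [s]) \<subseteq> E" using q2 qE r by simp_all
      show "v \<notin> set r" using q2 r by simp
      show "r \<noteq> []" "hd r = x" using q(2) d unfolding r by (cases r; auto)+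
    qed
  next
    case 2
    then show False using fork_via_y[OF f q2 qE(1) q] by blast
  qed
qed

lemma contradiction: False
proof -
  have E0: "E \<noteq> {}" using not_good decomposes_empty unfolding good_def by auto
  then have "V \<noteq> {}" using edge_V by blast
  moreover have "{e \<in> E. e \<subseteq> V} = E" using edge_V by blast
  ultimately obtain s where s: "s \<in> V" "degr E s \<le> 2"
    using degen unfolding two_degen_def by (metis order_refl)
  have high: "3 \<le> degr E w" if "w \<in> V" "w \<noteq> s" for w
    using low_unique[of w s] that s by (cases "degr E w \<le> 2") auto
  \<comment> \<open>Degeneracy is applied again after deletion of \<open>s\<close>. The vertex
    \<open>v\<close> found there has degree at least 3 in \<open>E\<close> but at most 2 without
    \<open>s\<close>, so it is a neighbour of \<open>s\<close> of degree exactly 3.\<close>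
  define W where "W = V - {s}"
  define F where "F = {e \<in> E. e \<subseteq> W}"
  have "W \<noteq> {}"
  proof
    assume "W = {}"
    then have "V \<subseteq> {s}" unfolding W_def by blast
    then have "card e \<le> 1" if "e \<in> E" for e using edge_V[OF that] by (auto simp: subset_singleton_iff)
    then show False using E0 simple_graph unfolding ugraph_def by fastforce
  qed
  then obtain v where v: "v \<in> W" "degr F v \<le> 2"
    using degen unfolding two_degen_def F_def W_def by (metis Diff_subset)
  have simple_graph_F: "ugraph W F" by (rule ugraph_sub[OF simple_graph]) (auto simp: W_def F_def)
  have nF: "nbrs F v = nbrs E v - {s}"
    using v(1) nbrs_V unfolding nbrs_def F_def W_def by auto
  have vs: "v \<in> V" "v \<noteq> s" using v(1) unfolding W_def by auto
  have c2: "card (nbrs E v - {s}) \<le> 2" using v(2) degr_nbrs[OF simple_graph_F, of v] nF by simp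
  have c3: "3 \<le> card (nbrs E v)" using high[OF vs] unfolding degr_card .
  have sv: "s \<in> nbrs E v" using c2 c3 by (cases "s \<in> nbrs E v") auto
  then have "card (nbrs E v - {s}) = 2" using c2 c3 by simp
  then obtain x y where xy: "nbrs E v - {s} = {x, y}" "x \<noteq> y" by (meson card_2_iff)
  then have nv: "nbrs E v = {s, x, y}" and d: "s \<noteq> x" "s \<noteq> y" using sv by auto
  have xV: "x \<in> V" "y \<in> V" using nv nbrs_V[of x v] nbrs_V[of y v] by auto
  have vn: "v \<in> nbrs E s" using sv nbrs_sym by blast
  show False
  proof (cases "nbrs E s = {v}")
    case True
    then have "fork v [] s x y" using nv xy(2) d unfolding fork_def by simp
    then show False using no_fork high[OF xV(1)] d by blast
  next
    case False
    then obtain b where b: "b \<in> nbrs E s" "b \<noteq> v" using vn by blast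
    have ns: "{v, b} = nbrs E s"
      using b vn s(2) fin_nbrs[of s] unfolding degr_card by (intro card_seteq) auto
    have sb: "s \<noteq> b" "b \<in> V" using nbrs_V[OF b(1)] by auto
    \<comment> \<open>The second neighbour of \<open>s\<close> either closes a triangle with
      \<open>s\<close> and \<open>v\<close> or completes a \<open>fork\<close>.\<close>
    consider "b = x" | "b = y" | "b \<notin> {v, x, y}" using b(2) by blast
    then show False
    proof cases
      case 1
      then show False using low_triangle[of v s x y] nv ns d xy(2) high[OF xV(1)] by auto
    next
      case 2
      then show False using low_triangle[of v s y x] nv ns d xy(2) high[OF xV(2)] by auto
    next
      case 3
      then have "fork v [b] s x y" using nv ns xy(2) d unfolding fork_def by auto
      then show False using no_fork high[OF xV(1)] d by blast
    qed
  qed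
qed

end

lemma two_degen_good:
  assumes "two_degen V E" "no_triangle_component E"
  shows "good V E"
  using assms
proof (induction "card V" arbitrary: V E rule: less_induct)
  case less
  show ?case
  proof (rule ccontr)
    assume "\<not> good V E"
    then interpret counterexample V E
      using less by unfold_locales auto
    show False by (rule contradiction)
  qed
qed

section \<open>Back to digraphs\<close>

lemma decomposes_partition:
  "decomposes E k \<Longrightarrow> \<exists>P. finite P \<and> card P \<le> k \<and> partition_on E P \<and>
    (\<forall>F\<in>P. \<exists>p. distinct p \<and> 2 \<le> length p \<and> F = path_uedges p)"
proof (induction rule: decomposes.induct)
  case decomposes_empty
  show ?case by (intro exI[of _ "{}"]) (simp add: partition_on_empty)
next
  case (decomposes_path E k p)
  from decomposes_path.IH obtain P where P: "finite P" "card P \<le> k" "partition_on E P"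
    "\<forall>F\<in>P. \<exists>p. distinct p \<and> 2 \<le> length p \<and> F = path_uedges p" by (elim exE conjE)
  have "path_uedges p \<noteq> {}" using decomposes_path.hyps(3) by (cases p rule: remdups_adj.cases) simp_all
  moreover have "path_uedges p \<inter> F = {}" if "F \<in> P" for F
    using P(3) decomposes_path.hyps(4) that unfolding partition_on_def by blast
  ultimately have "partition_on (path_uedges p \<union> E) (insert (path_uedges p) P)"
    using P(3) unfolding partition_on_def pairwise_insert disjnt_def by (simp add: Int_commute)
  moreover have "card (insert (path_uedges p) P) \<le> Suc k" using P(1,2) by (simp add: card_insert_if)
  moreover have "\<exists>q. distinct q \<and> 2 \<le> length q \<and> F = path_uedges q"
    if "F \<in> insert (path_uedges p) P" for F
  proof (cases "F = path_uedges p")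
    case True
    then show ?thesis using decomposes_path.hyps(2,3) by (intro exI[of _ p]) simp
  next
    case False
    then show ?thesis using that P(4) by simp
  qed
  ultimately show ?case using P(1) by (meson finite_insert)
qed

lemma uedges_iff:
  assumes "symmetric G"
  shows "{u, v} \<in> uedges G \<longleftrightarrow> (u, v) \<in> arcs_ends G"
proof
  assume "{u, v} \<in> uedges G"
  then obtain a b where ab: "(a, b) \<in> arcs_ends G" "{u, v} = {a, b}" unfolding uedges_def by auto
  then show "(u, v) \<in> arcs_ends G"
    using arcs_ends_symmetric[OF assms ab(1)] by (auto simp: doubleton_eq_iff)
qed (force simp: uedges_def)

context graph
begin

lemma ugraph_uedges: "ugraph (verts G) (uedges G)"
  unfolding ugraph_def
proof (intro conjI ballI)
  fix e assume "e \<in> uedges G"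
  then obtain a where "a \<in> arcs G" "e = {tail G a, head G a}" unfolding uedges_def arcs_ends_conv by auto
  then show "e \<subseteq> verts G" "card e = 2" using no_loops by simp_all
qed simp

lemma graph_induced:
  assumes "W \<subseteq> verts G"
  shows "graph (G \<restriction> W)"
proof -
  have i: "induced_subgraph (G \<restriction> W) G" by (rule induced_induce[OF assms])
  show ?thesis
    by (rule digraph.graphI[OF digraphI_induced[OF i] induced_graph_imp_symmetric[OF sym_arcs i]])
qed

lemma uedges_induced: "uedges (G \<restriction> W) = {e \<in> uedges G. e \<subseteq> W}"
proof (intro equalityI subsetI)
  fix e assume "e \<in> {e \<in> uedges G. e \<subseteq> W}"
  then obtain a where a: "a \<in> arcs G" "e = {tail G a, head G a}" "e \<subseteq> W"
    unfolding uedges_def arcs_ends_conv by auto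
  then have "a \<in> arcs (G \<restriction> W)" by simp
  then show "e \<in> uedges (G \<restriction> W)" using a(2) unfolding uedges_def arcs_ends_conv by force
qed (auto simp: uedges_def arcs_ends_conv)

text \<open>The induced subgraph on \<open>W\<close> is again a \<open>graph\<close>, so degeneracy
  applies to it and its out-degrees are the undirected degrees.\<close>

lemma two_degen_uedges:
  assumes "degenerate 2 G"
  shows "two_degen (verts G) (uedges G)"
  unfolding two_degen_def
proof (intro conjI allI impI ugraph_uedges)
  fix W assume W: "W \<subseteq> verts G" "W \<noteq> {}"
  have H: "graph (G \<restriction> W)" by (rule graph_induced[OF W(1)])
  have "subgraph (G \<restriction> W) G" by (rule induced_imp_subgraph[OF induced_induce[OF W(1)]])
  then have "\<exists>v\<in>verts (G \<restriction> W). out_degree (G \<restriction> W) v \<le> 2"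
    using assms[unfolded degenerate_def, rule_format, of "G \<restriction> W"] H W(2) by simp
  then show "\<exists>v\<in>W. degr {e \<in> uedges G. e \<subseteq> W} v \<le> 2"
    by (simp only: out_degree_eq_card_uedges[OF H] uedges_induced degr_def induce_subgraph_verts)
qed

text \<open>No edge leaves a triangle component, so by connectedness its corners would be all
  vertices and \<open>G\<close> would be a triangle.\<close>

lemma no_triangle_component_uedges:
  assumes con: "Digraph_Component.connected G" and K: "\<not> complete_digraph 3 G"
  shows "no_triangle_component (uedges G)"
  unfolding no_triangle_component_def
proof (intro allI notI)
  fix a b c assume t: "triangle_component (uedges G) a b c"
  then have d: "a \<noteq> b" "b \<noteq> c" "a \<noteq> c" and T: "triangle a b c \<subseteq> uedges G" unfolding triangle_component_def by auto
  have TV: "a \<in> verts G" "b \<in> verts G" "c \<in> verts G"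
    using T ugraph_uedges unfolding triangle_def ugraph_def by auto
  have "v \<in> {a, b, c}" if v: "v \<in> verts G" for v
  proof -
    \<comment> \<open>Connectedness refers to the symmetric closure, whose reachability agrees with
      that of the symmetric \<open>G\<close>.\<close>
    have "a \<rightarrow>\<^sup>*\<^bsub>G\<^esub> v"
      using con TV(1) v unfolding connected_def strongly_connected_def
      by (simp add: reachable_mk_symmetric_eq[OF sym_arcs])
    then have "(a, v) \<in> (arcs_ends G)\<^sup>*" by (rule reachable_rtranclI)
    then show ?thesis
    proof (induction rule: rtrancl_induct)
      case (step y z)
      have "{y, z} \<in> uedges G" using step(2) uedges_iff[OF sym_arcs] by blast
      then have "{y, z} \<in> triangle a b c"
        using triangle_component_edges[OF t ugraph_finite[OF ugraph_uedges], of "{y, z}"] step(3) by blast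
      then show ?case unfolding triangle_def by (auto simp: doubleton_eq_iff)
    qed simp
  qed
  then have V: "verts G = {a, b, c}" using TV by blast
  have "(u, v) \<in> arcs_ends G \<longleftrightarrow> u \<in> {a, b, c} \<and> v \<in> {a, b, c} \<and> u \<noteq> v" for u v
  proof
    assume "(u, v) \<in> arcs_ends G"
    then have "{u, v} \<in> uedges G" using uedges_iff[OF sym_arcs] by blast
    then show "u \<in> {a, b, c} \<and> v \<in> {a, b, c} \<and> u \<noteq> v"
      using ugraph_irrefl[OF ugraph_uedges] unfolding V by blast
  next
    assume "u \<in> {a, b, c} \<and> v \<in> {a, b, c} \<and> u \<noteq> v"
    then have "{u, v} \<in> triangle a b c" unfolding triangle_def by (auto simp: insert_commute)
    then show "(u, v) \<in> arcs_ends G" using T uedges_iff[OF sym_arcs] by blast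
  qed
  then have "arcs_ends G = {(u, v). (u, v) \<in> verts G \<times> verts G \<and> u \<noteq> v}" unfolding V
    by (intro set_eqI) (simp only: split_paired_all mem_Collect_eq prod.case mem_Sigma_iff conj_assoc)
  moreover have "card (verts G) = 3" using d unfolding V by simp
  ultimately have "complete_digraph 3 G" unfolding complete_digraph_def by (intro conjI graph_axioms)
  then show False using K by blast
qed

lemma vpath_uedges:
  assumes "distinct p" "2 \<le> length p" "path_uedges p \<subseteq> uedges G"
  shows "vpath p G"
proof -
  have "(u, v) \<in> arcs_ends G" if "(u, v) \<in> set (vwalk_arcs p)" for u v
  proof -
    have "{u, v} \<in> path_uedges p" using that unfolding path_uedges_def by force
    then show ?thesis using assms(3) uedges_iff[OF sym_arcs] by blast
  qed
  moreover have "set p \<subseteq> verts G"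
    using Union_path_uedges[OF assms(2)] assms(3) ugraph_uedges unfolding ugraph_def by blast
  moreover have "p \<noteq> []" using assms(2) by auto
  ultimately show ?thesis using assms(1) by (auto simp: vpath_def vwalk_def)
qed

end

theorem theorem1:
  fixes G :: "('a, 'b) pre_digraph" and n :: nat
  assumes "Digraph.graph G"
    and "Digraph_Component.connected G"
    and "degenerate 2 G"
    and "card (verts G) = n"
    and "\<not> complete_digraph 3 G"
  shows "\<exists>P. path_decomposition G P \<and> card P \<le> n div 2"
proof -
  interpret graph G by (rule assms(1))
  have "good (verts G) (uedges G)"
    by (rule two_degen_good[OF two_degen_uedges[OF assms(3)] no_triangle_component_uedges[OF assms(2,5)]])
  then obtain k where k: "k \<le> n div 2" "decomposes (uedges G) k" unfolding good_def assms(4) by blast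
  from decomposes_partition[OF k(2)] obtain P where P: "card P \<le> k" "partition_on (uedges G) P"
    "\<forall>F\<in>P. \<exists>p. distinct p \<and> 2 \<le> length p \<and> F = path_uedges p" by (elim exE conjE)
  have "\<exists>p. vpath p G \<and> F = path_uedges p" if F: "F \<in> P" for F
  proof -
    obtain p where p: "distinct p" "2 \<le> length p" "F = path_uedges p" using P(3) F by blast
    have "F \<subseteq> uedges G" using P(2) F unfolding partition_on_def by blast
    then show ?thesis using vpath_uedges p by blast
  qed
  then have "path_decomposition G P" unfolding path_decomposition_def using P(2) by blast
  then show ?thesis using P(1) k(1) le_trans by blast
qed

end
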